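(* Let $d>0$, let $k:\mathbb R^n\to\mathbb R$ satisfy $k\in C(\mathbb R^n)\cap L^\infty(\mathbb R^n)$, $k\ge 0$, $k(0)>0$, $\int_{\mathbb R^n}k(x)\,dx=1$. Let $\Omega_0$ be a smooth and bounded domain in $\mathbb R^n$, $\ell_0$ a positive constant, and let $\gamma_0\in L^\infty(\mathbb R^n)$ satisfy $\gamma_0(x)=-\ell_0$ for $x\in\mathbb R^n\setminus\bar\Omega_0$, $\gamma_0|_{\bar\Omega_0}\ge 0$, $\gamma_0|_{\bar\Omega_0}\not\equiv 0$, and the extra condition $\gamma_0|_{\bar\Omega_0}\in C(\bar\Omega_0)$. Let $\gamma$ be the solution of $$\begin{cases}\displaystyle \gamma_t(t,x)=d\int_{\{\gamma>0\}}k(x-y)\gamma(t,y)\,dy-d\,\gamma(t,x)\chi_{\{\gamma>0\}}, & t>0,\ x\in\mathbb R^n,\\ \gamma(0,x)=\gamma_0(x), & x\in\mathbb R^n,\end{cases}$$ and set $\Omega(t)=\{x\in\mathbb R^n:\gamma(t,x)\ge0\}$. Then: (i) (Expansion) there exists $t_0>0$ such that $\Omega(t)=\Omega(0)$ for $0\le t\le t_0$, and $\Omega(t_1)\subseteq\Omega(t_2)$ for $0<t_1<t_2$. (ii) (Boundedness) there exists $R>0$, which depends on the initial data only, such that $\Omega(t)\subseteq B_R(0)$ for all $t>0$.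
   Context: $\chi_E$ is the characteristic function of $E$; $\{\gamma>0\}$ at time $t$ means $\{y\in\mathbb R^n:\gamma(t,y)>0\}$; $B_R(0)$ is the ball of radius $R$ centred at $0$ in $\mathbb R^n$. Under the stated hypotheses the problem has a unique classical solution $\gamma(t,\cdot)\in L^\infty(\mathbb R^n)$ defined for all $t>0$, and, since $\gamma_0|_{\bar\Omega_0}\in C(\bar\Omega_0)$, $\gamma(t,\cdot)$ is continuous in $\bar\Omega_0$ and in $\mathbb R^n\setminus\bar\Omega_0$ for every $t>0$. *)

theory Defs
  imports "HOL-Analysis.Analysis"
begin

definition L_infty :: "('a::euclidean_space \<Rightarrow> real) \<Rightarrow> bool" where
  "L_infty f \<longleftrightarrow> f \<in> borel_measurable lebesgue \<and> (\<exists>M. AE x in lebesgue. \<bar>f x\<bar> \<le> M)"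

fun C_diff :: "nat \<Rightarrow> ('a::euclidean_space \<Rightarrow> real) \<Rightarrow> bool" where
  "C_diff 0 f \<longleftrightarrow> continuous_on UNIV f"
| "C_diff (Suc m) f \<longleftrightarrow> (\<forall>x. f differentiable at x) \<and>
     (\<forall>v. C_diff m (\<lambda>x. frechet_derivative f (at x) v))"

definition C_infty :: "('a::euclidean_space \<Rightarrow> real) \<Rightarrow> bool" where
  "C_infty f \<longleftrightarrow> (\<forall>m. C_diff m f)"

text \<open>
  A bounded domain has smooth boundary if near every boundary point it is the region on one side
  of the graph of a smooth function over a hyperplane. The unit vector \<open>e\<close> is the direction
  normal to that hyperplane, and \<open>x - (x \<bullet> e) *\<^sub>R e\<close> is the orthogonal projection of \<open>x\<close> onto it,
  so only the values of \<open>g\<close> on the hyperplane matter. In dimension one the hyperplane is a point.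
\<close>

definition smooth_bounded_domain :: "'a::euclidean_space set \<Rightarrow> bool" where
  "smooth_bounded_domain U \<longleftrightarrow>
     open U \<and> connected U \<and> U \<noteq> {} \<and> bounded U \<and>
     (\<forall>p\<in>frontier U. \<exists>r>0. \<exists>e g. norm e = 1 \<and> C_infty g \<and>
        U \<inter> ball p r = {x \<in> ball p r. x \<bullet> e > g (x - (x \<bullet> e) *\<^sub>R e)})"

text \<open>
  Classical solutions on \<open>[0, \<infinity>)\<close>: the equation holds for every \<open>t > 0\<close> and every point \<open>x\<close>, and
  the initial value is attained pointwise and continuously in time. Values of \<open>\<gamma>\<close> at negative
  times are irrelevant.
\<close>

definition is_solution ::
  "real \<Rightarrow> ('a::euclidean_space \<Rightarrow> real) \<Rightarrow> ('a \<Rightarrow> real) \<Rightarrow> (real \<Rightarrow> 'a \<Rightarrow> real) \<Rightarrow> bool" where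
  "is_solution d k \<gamma>0 \<gamma> \<longleftrightarrow>
     (\<forall>t>0. L_infty (\<gamma> t)) \<and>
     (\<forall>x. continuous_on {0..} (\<lambda>t. \<gamma> t x)) \<and>
     (\<forall>t>0. \<forall>x. ((\<lambda>s. \<gamma> s x) has_real_derivative
         (d * (LINT y:{y. \<gamma> t y > 0}|lebesgue. k (x - y) * \<gamma> t y)
          - d * \<gamma> t x * indicator {y. \<gamma> t y > 0} x)) (at t)) \<and>
     (\<forall>x. \<gamma> 0 x = \<gamma>0 x)"

definition Omega :: "(real \<Rightarrow> 'a \<Rightarrow> real) \<Rightarrow> real \<Rightarrow> 'a set" where
  "Omega \<gamma> t = {x. \<gamma> t x \<ge> 0}"

end

theory Submission
  imports Defs
begin

text \<open>
  Write \<open>u = max 0 \<gamma>\<close> and let \<open>k * u\<close> be the convolution. After the change of clock \<open>t \<mapsto> t / d\<close> the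
  equation reads \<open>\<gamma>' = k * u - u\<close> at every point (\<open>rescaled_solution_is_flow\<close>), so \<open>d\<close> disappears
  from all later estimates; this is why the radius in the second claim is the same for every
  \<open>d\<close> and every solution.

  Expansion. Where \<open>\<gamma>\<close> is negative it can only grow, so \<open>min 0 \<gamma>\<close> is nondecreasing in time
  (\<open>neg_part_mono\<close>); in particular a point that has become nonnegative stays so. The only loss is
  at rate \<open>u\<close>, hence \<open>exp t * u\<close> is nondecreasing too, and the mere boundedness of \<open>\<gamma>\<close> at a later
  time \<open>T\<close> bounds \<open>u\<close>, and with it the gain \<open>k * u\<close>, on all of \<open>[0, T]\<close> (\<open>gain_bounded\<close>). A point
  starting at \<open>- l0\<close> therefore needs a positive time to reach \<open>0\<close>, uniformly in the point.

  Boundedness. A point \<open>x\<close> outside the initial domain starts at \<open>- l0\<close> and is driven by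
  \<open>(k * u) x\<close> alone, so it is enough that the time integral of \<open>(k * u) x\<close> over the whole half line
  stays below \<open>l0\<close> when \<open>x\<close> is far away. Late and early times are treated separately.

  Late times: the integral of \<open>\<gamma> t - \<gamma> 0\<close> is never positive (\<open>heat_balance\<close>), while every point
  newly made positive contributes at least \<open>l0\<close> to it. Hence \<open>u t\<close> lives on a set whose measure is
  at most a constant \<open>A\<close> (\<open>positivity_set_measure\<close>). On functions supported in sets of measure at most \<open>A\<close>
  the quadratic form of \<open>u - k * u\<close> has a spectral gap \<open>\<mu>\<close> depending only on \<open>k\<close> and \<open>A\<close>
  (\<open>dissipation\<close>). So the square integral of \<open>u t\<close> decays like \<open>exp (- 2 * \<mu> * t)\<close>
  (\<open>energy_decay\<close>), and \<open>k * u\<close> decays like \<open>exp (- \<mu> * t)\<close> uniformly in space (\<open>gain_decay\<close>): the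
  contribution after a suitable time \<open>T\<close> is at most \<open>l0 / 4\<close> everywhere.

  Early times: there is an integrable bounded \<open>H\<close> above the initial datum with \<open>k * H \<le> 2 * H\<close>
  (\<open>supersolution_exists\<close>), and \<open>u t \<le> exp (2 * t) * H\<close> by comparison (\<open>u_le_majorant\<close>). Since \<open>k * H\<close>
  tends to zero at infinity (\<open>convol_vanishes_at_infinity\<close>), the contribution of \<open>[0, T]\<close> at
  \<open>x\<close> is at most \<open>l0 / 4\<close> once \<open>x\<close> is far enough away. All constants depend on \<open>k\<close> and the initial
  datum only.
\<close>


section \<open>Convolution with a probability density\<close>

lemma lborel_integral_affine:
  fixes f :: "'a::euclidean_space \<Rightarrow> real"
  assumes [measurable]: "f \<in> borel_measurable borel" and c: "c \<noteq> 0"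
  shows "integrable lborel (\<lambda>x. f (t + c *\<^sub>R x)) \<longleftrightarrow> integrable lborel f"
    and "(LINT x|lborel. f x) = \<bar>c\<bar> ^ DIM('a) * (LINT x|lborel. f (t + c *\<^sub>R x))"
proof -
  let ?D = "density (distr lborel borel (\<lambda>x. t + c *\<^sub>R x)) (\<lambda>_. \<bar>c\<bar>^DIM('a))"
  have "integrable lborel f \<longleftrightarrow> integrable ?D f"
    using lborel_affine[OF c, of t] by simp
  also have "\<dots> \<longleftrightarrow> integrable (distr lborel borel (\<lambda>x. t + c *\<^sub>R x)) (\<lambda>x. \<bar>c\<bar>^DIM('a) * f x)"
    by (subst integrable_density) auto
  also have "\<dots> \<longleftrightarrow> integrable lborel (\<lambda>x. \<bar>c\<bar>^DIM('a) * f (t + c *\<^sub>R x))"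
    by (subst integrable_distr_eq) auto
  finally show "integrable lborel (\<lambda>x. f (t + c *\<^sub>R x)) \<longleftrightarrow> integrable lborel f"
    using c by simp
  have "(LINT x|lborel. f x) = (LINT x|?D. f x)"
    using lborel_affine[OF c, of t] by simp
  also have "\<dots> = (LINT x|lborel. \<bar>c\<bar>^DIM('a) * f (t + c *\<^sub>R x))"
    by (subst integral_density) (auto simp: integral_distr)
  finally show "(LINT x|lborel. f x) = \<bar>c\<bar> ^ DIM('a) * (LINT x|lborel. f (t + c *\<^sub>R x))"
    by simp
qed

lemma lborel_integral_translate:
  fixes f :: "'a::euclidean_space \<Rightarrow> real"
  assumes f: "f \<in> borel_measurable borel"
  shows "integrable lborel (\<lambda>x. f (x - t)) \<longleftrightarrow> integrable lborel f"
    and "(LINT x|lborel. f (x - t)) = (LINT x|lborel. f x)"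
  using lborel_integral_affine[OF f, of 1 "- t"] by simp_all

lemma lborel_integral_reflect:
  fixes f :: "'a::euclidean_space \<Rightarrow> real"
  assumes f: "f \<in> borel_measurable borel"
  shows "integrable lborel (\<lambda>x. f (t - x)) \<longleftrightarrow> integrable lborel f"
    and "(LINT x|lborel. f (t - x)) = (LINT x|lborel. f x)"
  using lborel_integral_affine[OF f, of "-1" t] by simp_all

text \<open>
  Fubini arguments need \<open>(x, y) \<mapsto> u (x - y)\<close> to be measurable for the product \<open>\<sigma>\<close>-algebra, which fails
  for functions that are only Lebesgue measurable. Such arguments are therefore carried out for a
  Borel representative and transferred back.
\<close>

lemma borel_representative:
  fixes u :: "'a::euclidean_space \<Rightarrow> real"
  assumes "u \<in> borel_measurable lebesgue" "\<And>x. 0 \<le> u x"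
  obtains v where "v \<in> borel_measurable borel" "\<And>x. 0 \<le> v x" "AE x in lebesgue. u x = v x"
proof -
  obtain v0 where v0: "v0 \<in> borel_measurable lborel" "AE x in lborel. u x = v0 x"
    using completion_ex_borel_measurable_real[OF assms(1)] by auto
  show ?thesis
  proof (rule that[of "\<lambda>x. max 0 (v0 x)"])
    show "AE x in lebesgue. u x = max 0 (v0 x)"
      using AE_completion[OF v0(2)] by eventually_elim (use assms(2) in \<open>metis max.absorb2\<close>)
  qed (use v0(1) in auto)
qed

definition convol :: "('a::euclidean_space \<Rightarrow> real) \<Rightarrow> ('a \<Rightarrow> real) \<Rightarrow> 'a \<Rightarrow> real" where
  "convol k u x = (LINT y|lebesgue. k (x - y) * u y)"

locale dispersal_kernel =
  fixes k :: "'a::euclidean_space \<Rightarrow> real" and K :: real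
  assumes cont: "continuous_on UNIV k"
    and nonneg: "0 \<le> k x"
    and bound: "k x \<le> K"
    and pos: "0 < k 0"
    and int: "integrable lborel k"
    and mass: "(LINT x|lborel. k x) = 1"
begin

lemma meas[measurable]: "k \<in> borel_measurable borel"
  using cont by (simp add: borel_measurable_continuous_onI)

lemma shifted: "integrable lborel (\<lambda>y. k (x - y))" "(LINT y|lborel. k (x - y)) = 1"
  using lborel_integral_reflect[OF meas] int mass by auto

lemma shifted_lebesgue: "integrable lebesgue (\<lambda>y. k (x - y))" "(LINT y|lebesgue. k (x - y)) = 1"
  using shifted by (simp_all add: integrable_completion integral_completion)

lemma convol_integrable:
  assumes [measurable]: "u \<in> borel_measurable lebesgue" and "AE y in lebesgue. \<bar>u y\<bar> \<le> C"
  shows "integrable lebesgue (\<lambda>y. k (x - y) * u y)"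
proof (rule Bochner_Integration.integrable_bound)
  show "integrable lebesgue (\<lambda>y. C * k (x - y))"
    using shifted_lebesgue by simp
  have [measurable]: "(\<lambda>y. k (x - y)) \<in> borel_measurable lebesgue"
    using shifted_lebesgue(1) by blast
  show "(\<lambda>y. k (x - y) * u y) \<in> borel_measurable lebesgue"
    by measurable
  show "AE y in lebesgue. norm (k (x - y) * u y) \<le> norm (C * k (x - y))"
    using assms(2)
  proof eventually_elim
    case (elim y)
    then have "k (x - y) * \<bar>u y\<bar> \<le> k (x - y) * \<bar>C\<bar>"
      using nonneg by (intro mult_left_mono) auto
    then show ?case using nonneg by (simp add: abs_mult mult.commute)
  qed
qed

lemma convol_mono:
  assumes "u \<in> borel_measurable lebesgue" "AE y in lebesgue. \<bar>u y\<bar> \<le> C"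
    and "v \<in> borel_measurable lebesgue" "AE y in lebesgue. \<bar>v y\<bar> \<le> C'"
    and "AE y in lebesgue. u y \<le> v y"
  shows "convol k u x \<le> convol k v x"
  unfolding convol_def
proof (rule integral_mono_AE)
  show "AE y in lebesgue. k (x - y) * u y \<le> k (x - y) * v y"
    using assms(5) by eventually_elim (simp add: nonneg mult_left_mono)
qed (rule convol_integrable[OF assms(1,2)] convol_integrable[OF assms(3,4)])+

lemma convol_const: "convol k (\<lambda>_. c) x = c"
  using shifted_lebesgue by (simp add: convol_def)

lemma convol_nonneg: "(\<And>y. 0 \<le> u y) \<Longrightarrow> 0 \<le> convol k u x"
  unfolding convol_def by (intro Bochner_Integration.integral_nonneg) (simp add: nonneg)

lemma convol_le_const:
  assumes "u \<in> borel_measurable lebesgue" "\<And>y. 0 \<le> u y" "AE y in lebesgue. u y \<le> C"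
  shows "convol k u x \<le> C"
proof -
  have "convol k u x \<le> convol k (\<lambda>_. C) x"
    using assms by (intro convol_mono[of _ C _ "\<bar>C\<bar>"]) auto
  then show ?thesis by (simp add: convol_const)
qed

lemma convol_affine:
  assumes "u \<in> borel_measurable lebesgue" "AE y in lebesgue. \<bar>u y\<bar> \<le> C"
  shows "convol k (\<lambda>y. a * u y + b) x = a * convol k u x + b"
proof -
  have "convol k (\<lambda>y. a * u y + b) x = (LINT y|lebesgue. a * (k (x - y) * u y) + b * k (x - y))"
    unfolding convol_def by (intro Bochner_Integration.integral_cong) (auto simp: algebra_simps)
  also have "\<dots> = a * convol k u x + b"
    using convol_integrable[OF assms] shifted_lebesgue unfolding convol_def
    by (subst Bochner_Integration.integral_add) auto
  finally show ?thesis .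
qed

lemma convol_cong_AE:
  assumes [measurable]: "u \<in> borel_measurable lebesgue" "v \<in> borel_measurable lebesgue"
    and "AE y in lebesgue. u y = v y"
  shows "convol k u x = convol k v x"
  unfolding convol_def
proof (rule integral_cong_AE)
  have [measurable]: "(\<lambda>y. k (x - y)) \<in> borel_measurable lebesgue"
    using shifted_lebesgue(1) by blast
  show "(\<lambda>y. k (x - y) * u y) \<in> borel_measurable lebesgue" "(\<lambda>y. k (x - y) * v y) \<in> borel_measurable lebesgue"
    by measurable
  show "AE y in lebesgue. k (x - y) * u y = k (x - y) * v y"
    using assms(3) by eventually_elim simp
qed

lemma convol_lborel:
  assumes [measurable]: "v \<in> borel_measurable borel"
  shows "convol k v x = (LINT y|lborel. k (x - y) * v y)"
  unfolding convol_def by (rule integral_completion) simp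

lemma convol_borel_measurable:
  assumes [measurable]: "v \<in> borel_measurable borel"
  shows "convol k v \<in> borel_measurable borel"
proof -
  have "(\<lambda>x. LINT y|lborel. k (x - y) * v y) \<in> borel_measurable borel"
    by measurable
  moreover have "convol k v = (\<lambda>x. LINT y|lborel. k (x - y) * v y)"
    using convol_lborel[OF assms] by (intro ext)
  ultimately show ?thesis by simp
qed

text \<open>
  The convolution does not see changes of \<open>u\<close> on null sets, so it is Borel measurable even when \<open>u\<close>
  is only Lebesgue measurable.
\<close>

lemma convol_measurable:
  assumes u: "u \<in> borel_measurable lebesgue" "\<And>y. 0 \<le> u y"
  shows "convol k u \<in> borel_measurable borel"
proof -
  obtain v where v: "v \<in> borel_measurable borel" "\<And>x. 0 \<le> v x" "AE x in lebesgue. u x = v x"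
    using borel_representative[OF u] by blast
  have "convol k u = convol k v"
    using v u by (intro ext convol_cong_AE) (auto intro: measurable_completion)
  then show ?thesis using convol_borel_measurable[OF v(1)] by simp
qed

text \<open>
  A particle of \<open>u\<close> is redistributed with probability density \<open>k\<close>, so no mass is gained or lost.
\<close>

lemma convol_mass:
  assumes u: "integrable lebesgue u" "\<And>y. 0 \<le> u y"
  shows "integrable lebesgue (convol k u)" "(LINT x|lebesgue. convol k u x) = (LINT x|lebesgue. u x)"
proof -
  have um: "u \<in> borel_measurable lebesgue" using u(1) by auto
  obtain v where v[measurable]: "v \<in> borel_measurable borel" and v0: "\<And>x. 0 \<le> v x"
    and uv: "AE x in lebesgue. u x = v x"
    using borel_representative[OF um u(2)] by blast
  have iv: "integrable lborel v"
    using integrable_cong_AE[THEN iffD1, OF um _ uv u(1)] v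
    by (simp add: integrable_completion measurable_completion)
  have eq: "convol k u = convol k v"
    using v um uv by (intro ext convol_cong_AE) (auto intro: measurable_completion)
  have cv: "convol k v x = (LINT y|lborel. k (x - y) * v y)" for x
    by (rule convol_lborel) fact
  have int1: "integrable (lborel \<Otimes>\<^sub>M lborel) (\<lambda>(y, x). k (x - y) * v y)"
  proof (rule lborel_pair.Fubini_integrable)
    show "(\<lambda>(y, x). k (x - y) * v y) \<in> borel_measurable (lborel \<Otimes>\<^sub>M lborel)"
      by measurable
    have "(LINT x|lborel. norm (k (x - y) * v y)) = v y" for y
      using lborel_integral_translate[OF meas, of y] mass nonneg v0 by (simp add: abs_mult)
    then show "integrable lborel (\<lambda>y. LINT x|lborel. norm (case (y, x) of (y, x) \<Rightarrow> k (x - y) * v y))"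
      using iv by simp
    show "AE y in lborel. integrable lborel (\<lambda>x. case (y, x) of (y, x) \<Rightarrow> k (x - y) * v y)"
      using lborel_integral_translate(1)[OF meas] int by simp
  qed
  have i2: "integrable lborel (convol k v)"
    using lborel_pair.integrable_snd[OF int1] by (simp add: cv[abs_def] cv)
  then show "integrable lebesgue (convol k u)"
    unfolding eq using convol_borel_measurable[OF v] by (simp add: integrable_completion)
  have "(LINT x|lebesgue. convol k u x) = (LINT x|lborel. convol k v x)"
    unfolding eq using convol_borel_measurable[OF v] by (simp add: integral_completion)
  also have "\<dots> = (LINT y|lborel. LINT x|lborel. k (x - y) * v y)"
    using lborel_pair.Fubini_integral[OF int1] by (simp add: cv)
  also have "\<dots> = (LINT y|lborel. v y)"
    using lborel_integral_translate(2)[OF meas] mass by simp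
  also have "\<dots> = (LINT y|lebesgue. v y)"
    by (simp add: integral_completion)
  also have "\<dots> = (LINT y|lebesgue. u y)"
    using um v uv by (intro integral_cong_AE) (auto intro: measurable_completion)
  finally show "(LINT x|lebesgue. convol k u x) = (LINT x|lebesgue. u x)" .
qed

end

section \<open>Decay at infinity and an integrable supersolution\<close>

lemma tail_integral_small:
  fixes f :: "'a::euclidean_space \<Rightarrow> real"
  assumes f: "integrable lebesgue f" and "0 < \<epsilon>"
  obtains \<rho> where "0 < \<rho>" "(LINT y|lebesgue. indicator {y. \<rho> \<le> norm y} y * f y) \<le> \<epsilon>"
proof -
  have [measurable]: "f \<in> borel_measurable lebesgue" using f by auto
  have "closed {y::'a. c \<le> norm y}" for c
    by (intro closed_Collect_le continuous_intros)
  then have [measurable]: "{y::'a. c \<le> norm y} \<in> sets lebesgue" for c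
    by (simp add: borel_closed sets_completionI_sets)
  have "(\<lambda>n. LINT y|lebesgue. indicator {y. real n \<le> norm y} y * f y) \<longlonglongrightarrow> (LINT (y::'a)|lebesgue. 0)"
  proof (rule integral_dominated_convergence[where w = "\<lambda>y. \<bar>f y\<bar>"])
    show "AE y in lebesgue. (\<lambda>n. indicator {y. real n \<le> norm y} y * f y) \<longlonglongrightarrow> 0"
    proof (rule AE_I2)
      fix y :: 'a
      obtain N :: nat where N: "norm y < real N" using reals_Archimedean2 by blast
      have "\<forall>\<^sub>F n in sequentially. indicator {y. real n \<le> norm y} y * f y = 0"
        using eventually_ge_at_top[of N] by eventually_elim (use N in auto)
      then show "(\<lambda>n. indicator {y. real n \<le> norm y} y * f y) \<longlonglongrightarrow> 0"
        by (rule tendsto_eventually)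
    qed
    show "AE y in lebesgue. norm (indicator {y. real n \<le> norm y} y * f y) \<le> \<bar>f y\<bar>" for n
      by (auto simp: indicator_def)
  qed (use f in auto)
  then have "\<forall>\<^sub>F n in sequentially. (LINT y|lebesgue. indicator {y. real n \<le> norm y} y * f y) < \<epsilon>"
    using \<open>0 < \<epsilon>\<close> by (intro order_tendstoD(2)) auto
  then obtain N where "\<forall>n\<ge>N. (LINT y|lebesgue. indicator {y. real n \<le> norm y} y * f y) < \<epsilon>"
    by (auto simp: eventually_sequentially)
  then show ?thesis
    by (intro that[of "real (Suc N)"]) (auto simp: less_imp_le simp del: of_nat_Suc)
qed

context dispersal_kernel
begin

lemma K_nonneg: "0 \<le> K"
  using nonneg[of 0] bound[of 0] by linarith

text \<open>
  Young's inequality for \<open>k (x - y) * u y\<close> together with \<open>k\<^sup>2 \<le> K * k\<close>. The free parameter \<open>\<epsilon>\<close> is later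
  matched to the size of the square integral of \<open>u\<close>; this gives a pointwise bound of the gain that is
  uniform in \<open>x\<close>.
\<close>

lemma convol_young:
  assumes u2: "integrable lebesgue (\<lambda>y. (u y)\<^sup>2)" and "0 < \<epsilon>" and u0: "\<And>y. 0 \<le> u y"
  shows "convol k u x \<le> (\<epsilon> * K + (LINT y|lebesgue. (u y)\<^sup>2) / \<epsilon>) / 2"
proof -
  have le: "k (x - y) * u y \<le> (\<epsilon> * K * k (x - y) + (u y)\<^sup>2 / \<epsilon>) / 2" for y
  proof -
    have "2 * (k (x - y) * u y) * \<epsilon> \<le> (\<epsilon> * k (x - y))\<^sup>2 + (u y)\<^sup>2"
      using sum_squares_bound[of "\<epsilon> * k (x - y)" "u y"] by (simp add: algebra_simps)
    also have "(\<epsilon> * k (x - y))\<^sup>2 \<le> \<epsilon>\<^sup>2 * (K * k (x - y))"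
      unfolding power_mult_distrib power2_eq_square[of "k (x - y)"]
      using bound nonneg by (intro mult_left_mono mult_right_mono) auto
    finally show ?thesis
      using \<open>0 < \<epsilon>\<close> by (simp add: field_simps power2_eq_square)
  qed
  have "convol k u x \<le> (LINT y|lebesgue. (\<epsilon> * K * k (x - y) + (u y)\<^sup>2 / \<epsilon>) / 2)"
    unfolding convol_def using shifted_lebesgue(1)[of x] u2 le nonneg u0
    by (intro integral_mono') (auto intro!: add_nonneg_nonneg mult_nonneg_nonneg simp: K_nonneg less_imp_le[OF \<open>0 < \<epsilon>\<close>])
  also have "\<dots> = (\<epsilon> * K + (LINT y|lebesgue. (u y)\<^sup>2) / \<epsilon>) / 2"
    using shifted_lebesgue[of x] u2 by simp
  finally show ?thesis .
qed

text \<open>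
  If \<open>norm x \<ge> \<rho> + \<sigma>\<close> then for every \<open>y\<close> either \<open>norm y \<ge> \<rho>\<close> or \<open>norm (x - y) \<ge> \<sigma>\<close>. In the first case
  \<open>k\<close> is bounded and \<open>u\<close> has little mass left, in the second \<open>u\<close> is bounded and \<open>k\<close> has little
  mass left.
\<close>

lemma convol_vanishes_at_infinity:
  assumes u: "integrable lebesgue u" "\<And>y. 0 \<le> u y" "\<And>y. u y \<le> B" and "0 < \<epsilon>"
  obtains R where "0 < R" "\<And>x. R \<le> norm x \<Longrightarrow> convol k u x \<le> \<epsilon>"
proof -
  have B: "0 \<le> B" using u(2)[of 0] u(3)[of 0] by linarith
  have kl: "integrable lebesgue k" using int by (simp add: integrable_completion)
  obtain \<rho> where \<rho>: "0 < \<rho>" "(LINT y|lebesgue. indicator {y. \<rho> \<le> norm y} y * u y) \<le> \<epsilon> / (2 * (K + 1))"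
    using tail_integral_small[OF u(1), of "\<epsilon> / (2 * (K + 1))"] \<open>0 < \<epsilon>\<close> K_nonneg by auto
  obtain \<sigma> where \<sigma>: "0 < \<sigma>" "(LINT y|lebesgue. indicator {y. \<sigma> \<le> norm y} y * k y) \<le> \<epsilon> / (2 * (B + 1))"
    using tail_integral_small[OF kl, of "\<epsilon> / (2 * (B + 1))"] \<open>0 < \<epsilon>\<close> B by auto
  have [measurable]: "{y::'a. c \<le> norm y} \<in> sets borel" for c
    by (intro borel_closed closed_Collect_le continuous_intros)
  define k' where "k' y = indicator {y. \<sigma> \<le> norm y} y * k y" for y
  have [measurable]: "k' \<in> borel_measurable borel" unfolding k'_def by measurable
  have k'0: "0 \<le> k' y" for y using nonneg by (simp add: k'_def)
  have k'i: "integrable lborel k'"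
    using int by (rule Bochner_Integration.integrable_bound) (auto simp: k'_def indicator_def)
  have k'r: "integrable lebesgue (\<lambda>y. k' (x - y))" "(LINT y|lebesgue. k' (x - y)) = (LINT y|lebesgue. k' y)" for x
    using lborel_integral_reflect[of k' x] k'i by (auto simp: integrable_completion integral_completion)
  define u' where "u' y = indicator {y. \<rho> \<le> norm y} y * u y" for y
  have u'i: "integrable lebesgue u'"
    unfolding u'_def using integrable_mult_indicator[OF _ u(1), of "{y. \<rho> \<le> norm y}"] by simp
  have u'0: "0 \<le> u' y" for y using u(2) by (simp add: u'_def)
  show ?thesis
  proof (rule that[of "\<rho> + \<sigma>"])
    fix x :: 'a assume x: "\<rho> + \<sigma> \<le> norm x"
    have le: "k (x - y) * u y \<le> K * u' y + B * k' (x - y)" for y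
    proof (cases "\<rho> \<le> norm y")
      case True
      then have "k (x - y) * u y \<le> K * u' y"
        unfolding u'_def using bound u(2) by (simp add: mult_right_mono)
      then show ?thesis using B k'0[of "x - y"] by (smt (verit) mult_nonneg_nonneg)
    next
      case False
      then have "\<sigma> \<le> norm (x - y)" using x norm_triangle_sub[of x y] by linarith
      then have "k (x - y) * u y \<le> B * k' (x - y)"
        unfolding k'_def using u(3)[of y] nonneg[of "x - y"] by (simp add: mult.commute mult_right_mono)
      then show ?thesis using K_nonneg u'0[of y] by (smt (verit) mult_nonneg_nonneg)
    qed
    have "convol k u x \<le> (LINT y|lebesgue. K * u' y + B * k' (x - y))"
      unfolding convol_def using le u(2) nonneg k'r u'i
      by (intro integral_mono') (auto intro!: add_nonneg_nonneg mult_nonneg_nonneg simp: K_nonneg B k'0 u'0)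
    also have "\<dots> = K * (LINT y|lebesgue. u' y) + B * (LINT y|lebesgue. k' y)"
      using k'r u'i by simp
    also have "\<dots> \<le> K * (\<epsilon> / (2 * (K + 1))) + B * (\<epsilon> / (2 * (B + 1)))"
      using \<rho>(2) \<sigma>(2) K_nonneg B unfolding u'_def k'_def by (intro add_mono mult_left_mono) auto
    also have "\<dots> \<le> \<epsilon> / 2 + \<epsilon> / 2"
      using K_nonneg B \<open>0 < \<epsilon>\<close> by (intro add_mono) (auto simp: field_simps)
    finally show "convol k u x \<le> \<epsilon>" by simp
  qed (use \<rho> \<sigma> in auto)
qed

text \<open>
  The majorant is \<open>H = (\<Sum>j. (1/2) ^ j * (k * \<dots> * k * g))\<close> with \<open>j\<close> convolutions in the \<open>j\<close>-th term. Convolution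
  preserves the integral and the bound of \<open>g\<close>, so the geometric weights make the series converge, and
  splitting off the first term gives \<open>H = g + (k * H) / 2\<close>.
\<close>

lemma supersolution_exists:
  assumes g: "g \<in> borel_measurable borel" "integrable lborel g" "\<And>y. 0 \<le> g y" "\<And>y. g y \<le> B"
  obtains H where "H \<in> borel_measurable lebesgue" "integrable lebesgue H" "\<And>y. g y \<le> H y" "\<And>y. H y \<le> 2 * B"
    "\<And>x. convol k H x \<le> 2 * H x"
proof -
  define G where "G j = (convol k ^^ j) g" for j
  have G0: "G 0 = g" and GS: "G (Suc j) = convol k (G j)" for j
    by (simp_all add: G_def)
  have gb: "G j \<in> borel_measurable borel \<and> integrable lebesgue (G j) \<and>
      (LINT x|lebesgue. G j x) = (LINT x|lebesgue. g x) \<and> (\<forall>y. 0 \<le> G j y \<and> G j y \<le> B)" for j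
  proof (induction j)
    case 0
    then show ?case using g by (simp add: G0 integrable_completion)
  next
    case (Suc j)
    then have "G j \<in> borel_measurable lebesgue" by (auto intro: measurable_completion)
    then show ?case
      using Suc convol_borel_measurable[of "G j"] convol_mass[of "G j"]
        convol_nonneg[of "G j"] convol_le_const[of "G j" B] unfolding GS by auto
  qed
  have Gm[measurable]: "G j \<in> borel_measurable borel" and Gi: "integrable lebesgue (G j)"
    and GI: "(LINT x|lebesgue. G j x) = (LINT x|lebesgue. g x)" and Gn: "0 \<le> G j y" and GB: "G j y \<le> B" for j y
    using gb by auto
  have Gml[measurable]: "G j \<in> borel_measurable lebesgue" for j
    using Gi by auto
  have B: "0 \<le> B" using g(3)[of 0] g(4)[of 0] by linarith
  define H where "H y = (\<Sum>j. (1/2) ^ j * G j y)" for y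
  have geo: "summable (\<lambda>j. (1/2) ^ j * c)" for c :: real
    by (intro summable_mult2 summable_geometric) auto
  have smG: "summable (\<lambda>j. (1/2) ^ j * G j y)" for y
    by (rule summable_comparison_test'[OF geo[of B]]) (simp add: Gn GB mult_left_mono abs_mult)
  have Hm: "H \<in> borel_measurable lebesgue"
    unfolding H_def[abs_def] by measurable
  have Hi: "integrable lebesgue H"
    unfolding H_def[abs_def]
  proof (rule integrable_suminf)
    show "integrable lebesgue (\<lambda>y. (1/2) ^ j * G j y)" for j using Gi by simp
    show "AE y in lebesgue. summable (\<lambda>j. norm ((1/2) ^ j * G j y))"
      using smG Gn by (simp add: abs_mult)
    show "summable (\<lambda>j. LINT y|lebesgue. norm ((1/2) ^ j * G j y))"
      using Gn GI geo by (simp add: abs_mult)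
  qed
  have split: "H y = g y + 1/2 * (\<Sum>j. (1/2) ^ j * G (Suc j) y)" for y
  proof -
    have sm1: "summable (\<lambda>j. (1/2) ^ j * G (Suc j) y)"
      by (rule summable_comparison_test'[OF geo[of B]]) (simp add: Gn GB mult_left_mono abs_mult)
    have "H y = G 0 y + (\<Sum>j. (1/2) ^ Suc j * G (Suc j) y)"
      unfolding H_def using suminf_split_head[OF smG[of y]] by simp
    also have "(\<Sum>j. (1/2) ^ Suc j * G (Suc j) y) = 1/2 * (\<Sum>j. (1/2) ^ j * G (Suc j) y)"
      using suminf_mult[OF sm1, of "1/2"] by (simp add: mult.assoc)
    finally show ?thesis by (simp add: G0)
  qed
  have cH: "convol k H x = (\<Sum>j. (1/2) ^ j * G (Suc j) x)" for x
  proof -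
    have ci: "integrable lebesgue (\<lambda>y. k (x - y) * G j y)" for j
      by (rule convol_integrable[of _ B]) (auto simp: Gn GB)
    have "convol k H x = (LINT y|lebesgue. (\<Sum>j. (1/2) ^ j * (k (x - y) * G j y)))"
      unfolding convol_def H_def
      by (intro Bochner_Integration.integral_cong refl)
        (simp add: suminf_mult[OF smG, symmetric] mult.left_commute)
    also have "\<dots> = (\<Sum>j. LINT y|lebesgue. (1/2) ^ j * (k (x - y) * G j y))"
    proof (rule integral_suminf)
      show "integrable lebesgue (\<lambda>y. (1/2) ^ j * (k (x - y) * G j y))" for j using ci by simp
      have "summable (\<lambda>j. k (x - y) * ((1/2) ^ j * G j y))" for y
        by (intro summable_mult smG)
      then show "AE y in lebesgue. summable (\<lambda>j. norm ((1/2) ^ j * (k (x - y) * G j y)))"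
        using Gn nonneg by (simp add: abs_mult ac_simps)
      have "(LINT y|lebesgue. norm ((1/2) ^ j * (k (x - y) * G j y))) = (1/2) ^ j * G (Suc j) x" for j
        using Gn nonneg by (simp add: abs_mult GS convol_def)
      moreover have "summable (\<lambda>j. (1/2) ^ j * G (Suc j) x)"
        by (rule summable_comparison_test'[OF geo[of B]]) (simp add: Gn GB mult_left_mono abs_mult)
      ultimately show "summable (\<lambda>j. LINT y|lebesgue. norm ((1/2) ^ j * (k (x - y) * G j y)))"
        by simp
    qed
    also have "\<dots> = (\<Sum>j. (1/2) ^ j * G (Suc j) x)"
      by (simp add: GS convol_def)
    finally show ?thesis .
  qed
  have H_eq: "H x = g x + 1/2 * convol k H x" for x
    using split cH by simp
  have Hn: "0 \<le> H y" for y
    unfolding H_def using smG Gn by (intro suminf_nonneg) auto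
  have cHn: "0 \<le> convol k H x" for x
    using Hn by (rule convol_nonneg)
  show ?thesis
  proof (rule that[OF Hm Hi])
    show "g y \<le> H y" for y using H_eq[of y] cHn[of y] by simp
    show "convol k H x \<le> 2 * H x" for x using H_eq[of x] g(3)[of x] by simp
    have "H y \<le> (\<Sum>j. (1/2) ^ j * B)" for y
      unfolding H_def using smG geo GB by (intro suminf_le) (auto intro: mult_left_mono)
    also have "(\<Sum>j. (1/2) ^ j * B) = 2 * B"
      using suminf_mult2[of "\<lambda>j. (1/2::real) ^ j" B] suminf_geometric[of "1/2::real"]
      by (simp add: summable_geometric)
    finally show "H y \<le> 2 * B" for y .
  qed
qed

end

section \<open>A spectral gap on functions with small support\<close>

text \<open>
  Cauchy-Schwarz against the indicator of the support, in the form that the square integral of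
  \<open>v - c * indicator D\<close> is nonnegative for the mean value \<open>c\<close> of \<open>v\<close> relative to \<open>A\<close>.
\<close>

lemma square_integral_bound_by_support:
  fixes v :: "'a \<Rightarrow> real"
  assumes v: "integrable M v" and v2: "integrable M (\<lambda>x. (v x)\<^sup>2)"
    and D: "D \<in> sets M" "emeasure M D \<le> ennreal A" "\<And>x. x \<in> space M \<Longrightarrow> x \<notin> D \<Longrightarrow> v x = 0" and A: "0 < A"
  shows "(LINT x|M. v x)\<^sup>2 \<le> A * (LINT x|M. (v x)\<^sup>2)"
proof -
  have fin: "emeasure M D < \<infinity>" using D(2) by (simp add: order_le_less_trans[OF D(2)])
  have mD: "measure M D \<le> A"
    using D(2) A by (simp add: measure_def enn2real_leI)
  have iD: "integrable M (indicator D :: 'a \<Rightarrow> real)"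
    using D(1) fin by simp
  define c where "c = (LINT x|M. v x) / A"
  have eq: "(LINT x|M. (v x)\<^sup>2 - 2 * c * v x + c\<^sup>2 * indicator D x) = (LINT x|M. (v x - c * indicator D x)\<^sup>2)"
    using D(3) by (intro Bochner_Integration.integral_cong) (auto simp: indicator_def power2_eq_square algebra_simps)
  have "0 \<le> (LINT x|M. (v x - c * indicator D x)\<^sup>2)" by simp
  also have "\<dots> = (LINT x|M. (v x)\<^sup>2) - 2 * c * (LINT x|M. v x) + c\<^sup>2 * measure M D"
    unfolding eq[symmetric] using v v2 iD D(1) by (simp add: sets.Int_space_eq2)
  also have "\<dots> \<le> (LINT x|M. (v x)\<^sup>2) - 2 * c * (LINT x|M. v x) + c\<^sup>2 * A"
    using mD by (simp add: mult_left_mono)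
  also have "\<dots> = (LINT x|M. (v x)\<^sup>2) - (LINT x|M. v x)\<^sup>2 / A"
    using A by (simp add: c_def power2_eq_square field_simps)
  finally show ?thesis using A by (simp add: field_simps)
qed

text \<open>
  For the autocorrelation \<open>a z\<close> of \<open>v\<close>, the quantity \<open>2 * (energy - a z)\<close> is the squared distance in
  mean square between \<open>v\<close> and its translate by \<open>z\<close>. The quadratic form of the convolution is
  the average of \<open>a\<close> with weight \<open>k\<close>, so a spectral gap means that short translations
  already move \<open>v\<close> by a definite amount. Long translations do so because the support is
  small, and doubling passes this on to short ones.
\<close>

locale square_integrable =
  fixes v :: "'a::euclidean_space \<Rightarrow> real"
  assumes v_meas[measurable]: "v \<in> borel_measurable borel"
    and v_nonneg: "0 \<le> v x"
    and v_int: "integrable lborel v"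
    and v_sq: "integrable lborel (\<lambda>x. (v x)\<^sup>2)"
begin

definition autocorrelation :: "'a \<Rightarrow> real" where
  "autocorrelation z = (LINT x|lborel. v x * v (x - z))"

definition energy :: real where
  "energy = (LINT x|lborel. (v x)\<^sup>2)"

lemma sq_shift: "integrable lborel (\<lambda>x. (v (x - s))\<^sup>2)" "(LINT x|lborel. (v (x - s))\<^sup>2) = energy"
  using lborel_integral_translate[of "\<lambda>x. (v x)\<^sup>2" s] v_sq by (auto simp: energy_def)

lemma energy_nonneg: "0 \<le> energy"
  unfolding energy_def by simp

lemma product_integrable: "integrable lborel (\<lambda>x. v (x - s) * v (x - t))"
proof (rule Bochner_Integration.integrable_bound)
  show "integrable lborel (\<lambda>x. (v (x - s))\<^sup>2 + (v (x - t))\<^sup>2)"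
    using sq_shift by simp
  show "AE x in lborel. norm (v (x - s) * v (x - t)) \<le> norm ((v (x - s))\<^sup>2 + (v (x - t))\<^sup>2)"
  proof (rule AE_I2)
    fix x
    have "0 \<le> v (x - s) * v (x - t)" by (simp add: v_nonneg)
    then show "norm (v (x - s) * v (x - t)) \<le> norm ((v (x - s))\<^sup>2 + (v (x - t))\<^sup>2)"
      using sum_squares_bound[of "v (x - s)" "v (x - t)"] by simp
  qed
qed measurable

lemma autocorrelation_shift: "(LINT x|lborel. v (x - s) * v (x - s - z)) = autocorrelation z"
  using lborel_integral_translate(2)[of "\<lambda>x. v x * v (x - z)" s]
  by (simp add: autocorrelation_def)

lemma difference_energy:
  "integrable lborel (\<lambda>x. (v (x - s) - v (x - s - z))\<^sup>2)"
  "(LINT x|lborel. (v (x - s) - v (x - s - z))\<^sup>2) = 2 * (energy - autocorrelation z)"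
proof -
  have eq: "(\<lambda>x. (v (x - s) - v (x - s - z))\<^sup>2) =
      (\<lambda>x. (v (x - s))\<^sup>2 + (v (x - (s + z)))\<^sup>2 - 2 * (v (x - s) * v (x - (s + z))))"
    by (auto simp: power2_eq_square algebra_simps)
  show "integrable lborel (\<lambda>x. (v (x - s) - v (x - s - z))\<^sup>2)"
    unfolding eq using sq_shift product_integrable by auto
  show "(LINT x|lborel. (v (x - s) - v (x - s - z))\<^sup>2) = 2 * (energy - autocorrelation z)"
    unfolding eq using sq_shift[of s] sq_shift[of "s + z"] product_integrable[of s "s + z"] autocorrelation_shift[of s z]
    by (simp add: diff_diff_eq)
qed

lemma autocorrelation_le_energy: "autocorrelation z \<le> energy"
proof -
  have "0 \<le> (LINT x|lborel. (v (x - 0) - v (x - 0 - z))\<^sup>2)" by simp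
  then show ?thesis unfolding difference_energy(2) by simp
qed

lemma autocorrelation_nonneg: "0 \<le> autocorrelation z"
  unfolding autocorrelation_def by (intro Bochner_Integration.integral_nonneg) (simp add: v_nonneg)

text \<open>
  A translation by \<open>2 * z\<close> is two translations by \<open>z\<close>; the factor \<open>4\<close> comes from
  \<open>(p - q)\<^sup>2 \<le> 2 * (p - m)\<^sup>2 + 2 * (m - q)\<^sup>2\<close>.
\<close>

lemma autocorrelation_double: "energy - autocorrelation (2 *\<^sub>R z) \<le> 4 * (energy - autocorrelation z)"
proof -
  have "(LINT x|lborel. (v (x - 0) - v (x - 0 - 2 *\<^sub>R z))\<^sup>2) \<le>
      (LINT x|lborel. 2 * (v (x - 0) - v (x - 0 - z))\<^sup>2 + 2 * (v (x - z) - v (x - z - z))\<^sup>2)"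
  proof (rule integral_mono)
    fix x
    have "(p - q)\<^sup>2 \<le> 2 * (p - m)\<^sup>2 + 2 * (m - q)\<^sup>2" for p q m :: real
      using zero_le_power2[of "p + q - 2 * m"] by (simp add: power2_eq_square algebra_simps)
    from this[of "v x" "v (x - z - z)" "v (x - z)"]
    show "(v (x - 0) - v (x - 0 - 2 *\<^sub>R z))\<^sup>2 \<le> 2 * (v (x - 0) - v (x - 0 - z))\<^sup>2 + 2 * (v (x - z) - v (x - z - z))\<^sup>2"
      by (simp add: scaleR_2 diff_diff_eq)
  qed (intro difference_energy Bochner_Integration.integrable_add integrable_mult_right)+
  also have "\<dots> = 2 * (2 * (energy - autocorrelation z)) + 2 * (2 * (energy - autocorrelation z))"
    using difference_energy[of 0 z] difference_energy[of z z] by simp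
  finally show ?thesis
    unfolding difference_energy(2) by simp
qed

lemma autocorrelation_dyadic: "energy - autocorrelation (2 ^ m *\<^sub>R z) \<le> 4 ^ m * (energy - autocorrelation z)"
proof (induction m)
  case (Suc m)
  have "energy - autocorrelation (2 ^ Suc m *\<^sub>R z) \<le> 4 * (energy - autocorrelation (2 ^ m *\<^sub>R z))"
    using autocorrelation_double[of "2 ^ m *\<^sub>R z"] by simp
  also have "\<dots> \<le> 4 * (4 ^ m * (energy - autocorrelation z))"
    using Suc by simp
  finally show ?case by simp
qed simp

lemma autocorrelation_measurable[measurable]: "autocorrelation \<in> borel_measurable borel"
  unfolding autocorrelation_def[abs_def] by measurable

text \<open>
  Fubini for the nonnegative function \<open>w z * v x * v (x - c * z)\<close>. It is used with \<open>w = k\<close>, \<open>c = 1\<close>, where the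
  result is the quadratic form of the convolution, and with \<open>w\<close> the indicator of a ball and \<open>c\<close>
  a large power of two.
\<close>

lemma weighted_autocorrelation:
  assumes w: "integrable lborel w" "\<And>z. 0 \<le> w z" and c: "c \<noteq> 0"
  shows "integrable lborel (\<lambda>z. w z * autocorrelation (c *\<^sub>R z))"
    and "AE x in lborel. integrable lborel (\<lambda>z. w z * v x * v (x - c *\<^sub>R z))"
    and "integrable lborel (\<lambda>x. LINT z|lborel. w z * v x * v (x - c *\<^sub>R z))"
    and "(LINT z|lborel. w z * autocorrelation (c *\<^sub>R z)) = (LINT x|lborel. LINT z|lborel. w z * v x * v (x - c *\<^sub>R z))"
proof -
  have [measurable]: "w \<in> borel_measurable borel" using w by auto
  show ia: "integrable lborel (\<lambda>z. w z * autocorrelation (c *\<^sub>R z))"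
  proof (rule Bochner_Integration.integrable_bound)
    show "integrable lborel (\<lambda>z. w z * energy)" using w by simp
    show "AE z in lborel. norm (w z * autocorrelation (c *\<^sub>R z)) \<le> norm (w z * energy)"
      using autocorrelation_nonneg autocorrelation_le_energy w(2)
      by (auto simp: abs_mult energy_nonneg intro!: AE_I2 mult_left_mono)
  qed measurable
  have norm_eq: "(LINT x|lborel. norm (w z * v x * v (x - c *\<^sub>R z))) = w z * autocorrelation (c *\<^sub>R z)" for z
    using w(2) v_nonneg by (simp add: abs_mult mult.assoc autocorrelation_def)
  have int1: "integrable (lborel \<Otimes>\<^sub>M lborel) (\<lambda>(z, x). w z * v x * v (x - c *\<^sub>R z))"
  proof (rule lborel_pair.Fubini_integrable)
    show "(\<lambda>(z, x). w z * v x * v (x - c *\<^sub>R z)) \<in> borel_measurable (lborel \<Otimes>\<^sub>M lborel)"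
      by measurable
    show "integrable lborel (\<lambda>z. LINT x|lborel. norm (case (z, x) of (z, x) \<Rightarrow> w z * v x * v (x - c *\<^sub>R z)))"
      using ia norm_eq by simp
    show "AE z in lborel. integrable lborel (\<lambda>x. case (z, x) of (z, x) \<Rightarrow> w z * v x * v (x - c *\<^sub>R z))"
      using product_integrable[of 0] by (simp add: mult.assoc)
  qed
  show "AE x in lborel. integrable lborel (\<lambda>z. w z * v x * v (x - c *\<^sub>R z))"
    using lborel_pair.AE_integrable_snd[OF int1] by simp
  show "integrable lborel (\<lambda>x. LINT z|lborel. w z * v x * v (x - c *\<^sub>R z))"
    using lborel_pair.integrable_snd[OF int1] by simp
  show "(LINT z|lborel. w z * autocorrelation (c *\<^sub>R z)) = (LINT x|lborel. LINT z|lborel. w z * v x * v (x - c *\<^sub>R z))"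
    using lborel_pair.Fubini_integral[OF int1] by (simp add: mult.assoc autocorrelation_def)
qed

text \<open>
  Averaged over a strongly dilated set, the autocorrelation is small: at each \<open>x\<close> the integral of
  \<open>v (x - c * z)\<close> over all \<open>z\<close> already carries the factor \<open>1 / c ^ n\<close> in dimension \<open>n\<close>.
\<close>

lemma autocorrelation_average:
  assumes B: "B \<in> sets lborel" "emeasure lborel B < \<infinity>" and c: "c \<noteq> 0"
  shows "(LINT z|lborel. indicator B z * autocorrelation (c *\<^sub>R z)) \<le> (LINT x|lborel. v x)\<^sup>2 / \<bar>c\<bar> ^ DIM('a)"
proof -
  have w: "integrable lborel (indicator B :: 'a \<Rightarrow> real)" "\<And>z. 0 \<le> (indicator B z :: real)"
    using B by auto
  note wa = weighted_autocorrelation[OF w c]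
  have total: "(LINT z|lborel. v (x - c *\<^sub>R z)) = (LINT x|lborel. v x) / \<bar>c\<bar> ^ DIM('a)"
    and total_int: "integrable lborel (\<lambda>z. v (x - c *\<^sub>R z))" for x
    using lborel_integral_affine[OF v_meas, of "-c" x] v_int c by (auto simp: field_simps)
  have "(LINT z|lborel. indicator B z * autocorrelation (c *\<^sub>R z)) =
      (LINT x|lborel. LINT z|lborel. indicator B z * v x * v (x - c *\<^sub>R z))"
    by (rule wa(4))
  also have "\<dots> \<le> (LINT x|lborel. v x * ((LINT x|lborel. v x) / \<bar>c\<bar> ^ DIM('a)))"
  proof (rule integral_mono)
    show "(LINT z|lborel. indicator B z * v x * v (x - c *\<^sub>R z)) \<le> v x * ((LINT x|lborel. v x) / \<bar>c\<bar> ^ DIM('a))" for x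
    proof -
      have "(LINT z|lborel. indicator B z * v x * v (x - c *\<^sub>R z)) \<le> (LINT z|lborel. v x * v (x - c *\<^sub>R z))"
        using total_int by (intro integral_mono') (auto simp: indicator_def v_nonneg)
      then show ?thesis using total by simp
    qed
  qed (use wa(3) v_int in auto)
  also have "\<dots> = (LINT x|lborel. v x)\<^sup>2 / \<bar>c\<bar> ^ DIM('a)"
    by (simp add: power2_eq_square)
  finally show ?thesis .
qed

end

context dispersal_kernel
begin

text \<open>
  Near the origin \<open>k > k 0 / 2\<close>, on a ball \<open>B\<close> of measure \<open>b\<close>. For \<open>2 ^ m > 2 * A / b\<close> the translates of \<open>v\<close> by
  \<open>2 ^ m * z\<close>, \<open>z\<close> in \<open>B\<close>, are on average almost orthogonal to \<open>v\<close>, because the support of \<open>v\<close> has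
  measure at most \<open>A\<close>. Hence the average of \<open>energy - a (2 ^ m * z)\<close> over \<open>B\<close> is at least half the energy, and by
  \<open>autocorrelation_dyadic\<close> the average of \<open>energy - a z\<close> loses at most the factor \<open>4 ^ m\<close>.
\<close>

lemma dissipation_borel:
  assumes A: "0 < A"
  obtains \<mu> where "0 < \<mu>"
    "\<And>v. square_integrable v \<Longrightarrow> emeasure lborel {x. v x > 0} \<le> ennreal A \<Longrightarrow>
      (LINT x|lborel. v x * convol k v x) \<le> (1 - \<mu>) * (LINT x|lborel. (v x)\<^sup>2)"
proof -
  obtain r where r: "0 < r" "\<And>z. z \<in> ball 0 r \<Longrightarrow> k 0 / 2 < k z"
  proof -
    have "isCont k 0"
      using cont by (simp add: continuous_on_eq_continuous_at)
    then have "\<forall>\<^sub>F z in nhds 0. k 0 / 2 < k z"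
      using pos by (intro order_tendstoD(1)[of k "k 0"]) (auto simp: isCont_def tendsto_at_iff_tendsto_nhds)
    then obtain r where "0 < r" "\<And>z. dist z 0 < r \<Longrightarrow> k 0 / 2 < k z"
      by (auto simp: eventually_nhds_metric)
    then show ?thesis using that[of r] by (auto simp: dist_commute)
  qed
  define B where "B = ball (0::'a) r"
  define b where "b = measure lborel B"
  have Bm[measurable]: "B \<in> sets borel" and Bf: "emeasure lborel B < \<infinity>"
    using emeasure_bounded_finite[of "ball (0::'a) r"] by (auto simp: B_def)
  have b: "0 < b"
    unfolding b_def B_def using r by (simp add: content_ball_pos)
  \<comment> \<open>Dilating by this power of two spreads the ball far beyond the measure of the support.\<close>
  obtain m :: nat where m: "2 * A / b < 2 ^ m"
    using real_arch_pow[of 2] by auto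
  define \<mu> where "\<mu> = k 0 / 2 * (b / 2) / 4 ^ m"
  show ?thesis
  proof (rule that[of \<mu>])
    show "0 < \<mu>" using pos b by (simp add: \<mu>_def)
    fix v :: "'a \<Rightarrow> real" assume "square_integrable v" and supp: "emeasure lborel {x. v x > 0} \<le> ennreal A"
    then interpret square_integrable v by simp
    let ?a = autocorrelation
    have 1: "(LINT x|lborel. v x * convol k v x) = (LINT z|lborel. k z * ?a (1 *\<^sub>R z))"
    proof -
      have "convol k v x = (LINT z|lborel. k z * v (x - z))" for x
      proof -
        have "convol k v x = (LINT z|lborel. k (x - (x - z)) * v (x - z))"
          unfolding convol_lborel[OF v_meas]
          by (rule lborel_integral_reflect(2)[symmetric]) measurable
        then show ?thesis by simp
      qed
      then have "v x * convol k v x = (LINT z|lborel. k z * v x * v (x - 1 *\<^sub>R z))" for x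
        by (simp add: ac_simps flip: integral_mult_right_zero)
      then show ?thesis
        using weighted_autocorrelation(4)[OF int nonneg, of 1] by simp
    qed
    have iB: "integrable lborel (\<lambda>z. indicator B z * ?a (2 ^ m *\<^sub>R z))"
      using Bf by (intro weighted_autocorrelation(1)) auto
    have ik: "integrable lborel (\<lambda>z. k z * ?a z)"
      using weighted_autocorrelation(1)[OF int nonneg, of 1] by simp
    have iBc: "integrable lborel (indicator B :: 'a \<Rightarrow> real)"
      using Bf by auto
    have "(LINT x|lborel. v x)\<^sup>2 \<le> A * energy"
      unfolding energy_def
      by (rule square_integral_bound_by_support[OF v_int v_sq _ supp _ A]) (use v_nonneg in \<open>auto simp: less_le\<close>)
    then have "(LINT x|lborel. v x)\<^sup>2 / (2 ^ m) ^ DIM('a) \<le> A * energy / (2 ^ m) ^ DIM('a)"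
      by (simp add: divide_right_mono)
    also have "\<dots> \<le> A * energy / (2 ^ m)"
    proof (rule divide_left_mono)
      show "2 ^ m \<le> ((2::real) ^ m) ^ DIM('a)"
        using DIM_positive[where 'a='a] by (intro self_le_power) (auto simp: Suc_le_eq)
    qed (use A energy_nonneg in auto)
    also have "\<dots> \<le> energy * (b / 2)"
    proof -
      have "A / 2 ^ m \<le> b / 2" using m b by (simp add: field_simps)
      from mult_left_mono[OF this energy_nonneg] show ?thesis by (simp add: mult.commute)
    qed
    finally have half: "(LINT x|lborel. v x)\<^sup>2 / (2 ^ m) ^ DIM('a) \<le> energy * (b / 2)" .
    have "(LINT z|lborel. indicator B z * ?a (2 ^ m *\<^sub>R z)) \<le> (LINT x|lborel. v x)\<^sup>2 / (2 ^ m) ^ DIM('a)"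
      using autocorrelation_average[of B "2 ^ m"] Bf by simp
    from this half have avg: "(LINT z|lborel. indicator B z * ?a (2 ^ m *\<^sub>R z)) \<le> energy * (b / 2)"
      by (rule order_trans)
    have "energy * (b / 2) \<le> energy * b - (LINT z|lborel. indicator B z * ?a (2 ^ m *\<^sub>R z))"
      using avg by (simp add: algebra_simps)
    also have "\<dots> = (LINT z|lborel. indicator B z * (energy - ?a (2 ^ m *\<^sub>R z)))"
      using iB iBc by (simp add: right_diff_distrib b_def)
    also have "\<dots> \<le> (LINT z|lborel. 2 * 4 ^ m / k 0 * (k z * (energy - ?a z)))"
    proof (rule integral_mono)
      show "integrable lborel (\<lambda>z. indicator B z * (energy - ?a (2 ^ m *\<^sub>R z)))"
        using iB iBc by (simp add: right_diff_distrib)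
      show "integrable lborel (\<lambda>z. 2 * 4 ^ m / k 0 * (k z * (energy - ?a z)))"
        using ik int by (simp add: right_diff_distrib)
      fix z
      have nn: "0 \<le> energy - ?a z" using autocorrelation_le_energy by simp
      show "indicator B z * (energy - ?a (2 ^ m *\<^sub>R z)) \<le> 2 * 4 ^ m / k 0 * (k z * (energy - ?a z))"
      proof (cases "z \<in> B")
        case True
        then have "1 \<le> 2 / k 0 * k z" using r(2)[of z] pos by (simp add: B_def field_simps)
        from mult_right_mono[OF this, of "4 ^ m * (energy - ?a z)"]
        have "4 ^ m * (energy - ?a z) \<le> 2 * 4 ^ m / k 0 * (k z * (energy - ?a z))"
          using nn by (simp add: ac_simps)
        then show ?thesis using True autocorrelation_dyadic[of m z] by simp
      qed (use nn nonneg pos in simp)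
    qed
    also have "\<dots> = 2 * 4 ^ m / k 0 * (energy - (LINT z|lborel. k z * ?a z))"
      using ik int mass by (simp add: right_diff_distrib)
    finally have "\<mu> * energy \<le> energy - (LINT z|lborel. k z * ?a z)"
      using pos by (simp add: \<mu>_def field_simps)
    then show "(LINT x|lborel. v x * convol k v x) \<le> (1 - \<mu>) * (LINT x|lborel. (v x)\<^sup>2)"
      using 1 by (simp add: energy_def[symmetric] algebra_simps)
  qed
qed

lemma dissipation:
  assumes A: "0 < A"
  obtains \<mu> where "0 < \<mu>"
    "\<And>u. integrable lebesgue u \<Longrightarrow> integrable lebesgue (\<lambda>x. (u x)\<^sup>2) \<Longrightarrow> (\<And>x. 0 \<le> u x) \<Longrightarrow>
      emeasure lebesgue {x. u x > 0} \<le> ennreal A \<Longrightarrow>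
      (LINT x|lebesgue. u x * convol k u x) \<le> (1 - \<mu>) * (LINT x|lebesgue. (u x)\<^sup>2)"
proof -
  obtain \<mu> where \<mu>: "0 < \<mu>" and main: "\<And>v. square_integrable v \<Longrightarrow> emeasure lborel {x. v x > 0} \<le> ennreal A \<Longrightarrow>
      (LINT x|lborel. v x * convol k v x) \<le> (1 - \<mu>) * (LINT x|lborel. (v x)\<^sup>2)"
    using dissipation_borel[OF A] by blast
  show ?thesis
  proof (rule that[OF \<mu>])
    fix u :: "'a \<Rightarrow> real"
    assume u: "integrable lebesgue u" "integrable lebesgue (\<lambda>x. (u x)\<^sup>2)" and u0: "\<And>x. 0 \<le> u x"
      and supp: "emeasure lebesgue {x. u x > 0} \<le> ennreal A"
    have um[measurable]: "u \<in> borel_measurable lebesgue" using u by auto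
    obtain v where v[measurable]: "v \<in> borel_measurable borel" and v0: "\<And>x. 0 \<le> v x"
      and uv: "AE x in lebesgue. u x = v x"
      using borel_representative[OF um u0] by blast
    have vl[measurable]: "v \<in> borel_measurable lebesgue" by (auto intro: measurable_completion)
    have cm[measurable]: "convol k v \<in> borel_measurable borel" by (rule convol_borel_measurable) fact
    have cl[measurable]: "convol k v \<in> borel_measurable lebesgue" by (auto intro: measurable_completion)
    have eq: "convol k u = convol k v"
      using uv by (intro ext convol_cong_AE) auto
    have "square_integrable v"
    proof
      have "integrable lebesgue v" using integrable_cong_AE[THEN iffD1, OF um vl uv u(1)] .
      then show "integrable lborel v" by (simp add: integrable_completion)
      have "integrable lebesgue (\<lambda>x. (v x)\<^sup>2)"
        by (rule integrable_cong_AE[THEN iffD1, OF _ _ _ u(2)]) (use uv in auto)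
      then show "integrable lborel (\<lambda>x. (v x)\<^sup>2)" by (simp add: integrable_completion)
    qed (use v0 in auto)
    moreover have "emeasure lborel {x. v x > 0} \<le> ennreal A"
    proof -
      have m1: "{x. v x > 0} \<in> sets lborel" by measurable
      have "emeasure lborel {x. v x > 0} = emeasure lebesgue {x. v x > 0}"
        using m1 by simp
      also have "\<dots> = emeasure lebesgue {x. u x > 0}"
      proof (rule emeasure_eq_AE)
        show "AE x in lebesgue. (x \<in> {x. 0 < v x}) = (x \<in> {x. 0 < u x})"
          using uv by eventually_elim simp
        show "{x. 0 < u x} \<in> sets lebesgue"
          using measurable_sets[OF um, of "{0<..}"] by (simp add: vimage_def)
      qed (use m1 in auto)
      finally show ?thesis using supp by simp
    qed
    ultimately have "(LINT x|lborel. v x * convol k v x) \<le> (1 - \<mu>) * (LINT x|lborel. (v x)\<^sup>2)"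
      by (rule main)
    moreover have "(LINT x|lebesgue. u x * convol k u x) = (LINT x|lborel. v x * convol k v x)"
    proof -
      have "(LINT x|lebesgue. u x * convol k u x) = (LINT x|lebesgue. v x * convol k v x)"
        unfolding eq by (rule integral_cong_AE) (use uv in auto)
      then show ?thesis by (simp add: integral_completion)
    qed
    moreover have "(LINT x|lebesgue. (u x)\<^sup>2) = (LINT x|lborel. (v x)\<^sup>2)"
    proof -
      have "(LINT x|lebesgue. (u x)\<^sup>2) = (LINT x|lebesgue. (v x)\<^sup>2)"
        by (rule integral_cong_AE) (use uv in auto)
      then show ?thesis by (simp add: integral_completion)
    qed
    ultimately show "(LINT x|lebesgue. u x * convol k u x) \<le> (1 - \<mu>) * (LINT x|lebesgue. (u x)\<^sup>2)"
      by simp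
  qed
qed

end

section \<open>Calculus in the time variable\<close>

lemma deriv_comparison:
  fixes f g :: "real \<Rightarrow> real"
  assumes "a \<le> b" "continuous_on {a..b} f" "continuous_on {a..b} g"
    and "\<And>t. a < t \<Longrightarrow> t < b \<Longrightarrow> (f has_real_derivative f' t) (at t)"
    and "\<And>t. a < t \<Longrightarrow> t < b \<Longrightarrow> (g has_real_derivative g' t) (at t)"
    and "\<And>t. a < t \<Longrightarrow> t < b \<Longrightarrow> f' t \<le> g' t"
    and "f a \<le> g a"
  shows "f b \<le> g b"
proof -
  have "g a - f a \<le> g b - f b"
  proof (rule DERIV_nonneg_imp_increasing_open[of a b "\<lambda>t. g t - f t"])
    show "continuous_on {a..b} (\<lambda>t. g t - f t)"
      using assms by (intro continuous_intros)
    show "\<exists>y. ((\<lambda>t. g t - f t) has_real_derivative y) (at t) \<and> 0 \<le> y" if "a < t" "t < b" for t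
      using assms(4-6)[OF that] by (intro exI[of _ "g' t - f' t"]) (auto intro: DERIV_diff)
  qed fact
  then show ?thesis using assms(7) by simp
qed

text \<open>
  The positive part itself is not differentiable at \<open>0\<close>, but its square is; monotonicity of the negative
  part and the decay of the energy are therefore both read off from squares.
\<close>

lemma deriv_square_pos_part:
  "((\<lambda>x::real. (max 0 x)\<^sup>2) has_real_derivative 2 * max 0 x) (at x)"
proof -
  consider "x < 0" | "x = 0" | "0 < x" by linarith
  then show ?thesis
  proof cases
    case 1
    have "((\<lambda>x::real. 0) has_real_derivative 2 * max 0 x) (at x)" using 1 by simp
    then show ?thesis
      by (rule has_field_derivative_transform_within_open[of _ _ _ "{..<0}"]) (use 1 in auto)
  next
    case 2
    have "(\<lambda>h::real. (max 0 h)\<^sup>2 / h) = max 0"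
      by (auto simp: max_def power2_eq_square)
    moreover have "((\<lambda>h::real. max 0 h) \<longlongrightarrow> max 0 0) (at 0)"
      by (intro tendsto_intros)
    ultimately show ?thesis using 2 by (simp add: DERIV_def)
  next
    case 3
    have "((\<lambda>x::real. x\<^sup>2) has_real_derivative 2 * max 0 x) (at x)"
      using 3 by (auto intro!: derivative_eq_intros)
    then show ?thesis
      by (rule has_field_derivative_transform_within_open[of _ _ _ "{0<..}"]) (use 3 in auto)
  qed
qed

text \<open>
  The bound on the time derivative makes \<open>f\<close> Lipschitz in time with constant \<open>h x\<close>, which dominates the
  difference quotients. Only continuity is available at \<open>t = 0\<close>, so the derivative is stated on the open interval and
  continuity of the integral on the closed one.
\<close>

lemma differentiate_under_integral:
  fixes f f' :: "real \<Rightarrow> 'a \<Rightarrow> real"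
  assumes meas: "\<And>t. 0 \<le> t \<Longrightarrow> t \<le> T \<Longrightarrow> f t \<in> borel_measurable M"
    and meas': "\<And>t. 0 < t \<Longrightarrow> t < T \<Longrightarrow> f' t \<in> borel_measurable M"
    and init: "integrable M (f 0)"
    and cont: "\<And>x. continuous_on {0..T} (\<lambda>t. f t x)"
    and der: "\<And>t x. 0 < t \<Longrightarrow> t < T \<Longrightarrow> ((\<lambda>s. f s x) has_real_derivative f' t x) (at t)"
    and dom: "\<And>t x. 0 < t \<Longrightarrow> t < T \<Longrightarrow> \<bar>f' t x\<bar> \<le> h x"
    and h: "integrable M h" and T: "0 < T"
  shows "\<And>t. 0 \<le> t \<Longrightarrow> t \<le> T \<Longrightarrow> integrable M (f t)"
    and "continuous_on {0..T} (\<lambda>t. LINT x|M. f t x)"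
    and "\<And>t. 0 < t \<Longrightarrow> t < T \<Longrightarrow> ((\<lambda>s. LINT x|M. f s x) has_real_derivative (LINT x|M. f' t x)) (at t)"
proof -
  have h0: "0 \<le> h x" for x
    using dom[of "T/2" x] T abs_ge_zero[of "f' (T/2) x"] by linarith
  have lip1: "\<bar>f t x - f s x\<bar> \<le> h x * (t - s)" if "0 \<le> s" "s \<le> t" "t \<le> T" for s t x
  proof -
    have c: "continuous_on {s..t} (\<lambda>t. f t x)"
      using that by (intro continuous_on_subset[OF cont]) auto
    have "f t x \<le> f s x + h x * (t - s)"
      by (rule deriv_comparison[of s t _ _ "\<lambda>r. f' r x" "\<lambda>r. h x"])
        (use that c der dom h0 in \<open>auto intro!: derivative_eq_intros continuous_intros simp: abs_le_iff\<close>)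
    moreover have "f s x - h x * (t - s) \<le> f t x"
      by (rule deriv_comparison[of s t _ _ "\<lambda>r. - h x" "\<lambda>r. f' r x"])
        (use that c der dom h0 in \<open>auto intro!: derivative_eq_intros continuous_intros simp: abs_le_iff minus_le_iff\<close>)
    ultimately show ?thesis by (simp add: abs_le_iff)
  qed
  have lip: "\<bar>f t x - f s x\<bar> \<le> h x * \<bar>t - s\<bar>" if "s \<in> {0..T}" "t \<in> {0..T}" for s t x
    using lip1[of s t x] lip1[of t s x] that by (cases "s \<le> t") (auto simp: abs_minus_commute)
  show integ: "integrable M (f t)" if t: "0 \<le> t" "t \<le> T" for t
  proof (rule Bochner_Integration.integrable_bound)
    show "integrable M (\<lambda>x. \<bar>f 0 x\<bar> + h x * T)" using init h by auto
    show "AE x in M. norm (f t x) \<le> norm (\<bar>f 0 x\<bar> + h x * T)"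
    proof (rule AE_I2)
      fix x
      have "\<bar>f t x - f 0 x\<bar> \<le> h x * T"
        using lip[of 0 t x] t mult_left_mono[OF t(2) h0[of x]] by simp
      then show "norm (f t x) \<le> norm (\<bar>f 0 x\<bar> + h x * T)"
        using h0[of x] T by (simp add: abs_if split: if_splits)
    qed
  qed (use meas t in auto)
  have "(LINT x|M. h x)-lipschitz_on {0..T} (\<lambda>t. LINT x|M. f t x)"
  proof (rule lipschitz_onI)
    fix t s assume ts: "t \<in> {0..T}" "s \<in> {0..T}"
    have "dist (LINT x|M. f t x) (LINT x|M. f s x) = \<bar>LINT x|M. f t x - f s x\<bar>"
      using ts integ by (simp add: dist_real_def)
    also have "\<dots> \<le> (LINT x|M. \<bar>f t x - f s x\<bar>)"
      by (rule integral_abs_bound)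
    also have "\<dots> \<le> (LINT x|M. h x * \<bar>t - s\<bar>)"
      using ts integ h lip by (intro integral_mono) auto
    finally show "dist (LINT x|M. f t x) (LINT x|M. f s x) \<le> (LINT x|M. h x) * dist t s"
      by (simp add: dist_real_def)
  qed (use h0 in simp)
  then show "continuous_on {0..T} (\<lambda>t. LINT x|M. f t x)"
    by (rule lipschitz_on_continuous_on)
  fix t assume t: "0 < t" "t < T"
  define \<delta> where "\<delta> = min t (T - t)"
  have \<delta>: "0 < \<delta>" using t by (simp add: \<delta>_def)
  have "((\<lambda>e. ((LINT x|M. f (t + e) x) - (LINT x|M. f t x)) / e) \<longlongrightarrow> (LINT x|M. f' t x)) (at 0 within {-\<delta><..<\<delta>})"
    unfolding tendsto_at_iff_sequentially comp_def
  proof (intro allI impI)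
    fix X assume X: "\<forall>i. X i \<in> {-\<delta><..<\<delta>} - {0}" "X \<longlonglongrightarrow> 0"
    have tX: "t + X i \<in> {0..T}" "X i \<noteq> 0" for i
      using X(1)[rule_format, of i] by (auto simp: \<delta>_def)
    have lim: "(\<lambda>i. LINT x|M. (f (t + X i) x - f t x) / X i) \<longlonglongrightarrow> (LINT x|M. f' t x)"
    proof (rule integral_dominated_convergence[where w = h])
      show "AE x in M. (\<lambda>i. (f (t + X i) x - f t x) / X i) \<longlonglongrightarrow> f' t x"
      proof (rule AE_I2)
        fix x
        have "(\<lambda>e. (f (t + e) x - f t x) / e) \<midarrow>0\<rightarrow> f' t x"
          using der[OF t, of x] by (simp add: DERIV_def)
        then show "(\<lambda>i. (f (t + X i) x - f t x) / X i) \<longlonglongrightarrow> f' t x"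
          using X(2) tX(2) unfolding tendsto_at_iff_sequentially comp_def by auto
      qed
      show "AE x in M. norm ((f (t + X i) x - f t x) / X i) \<le> h x" for i
        using lip[of t "t + X i"] tX[of i] t by (intro AE_I2) (auto simp: field_simps)
    qed (use h meas meas' t tX integ in auto)
    have eq: "(LINT x|M. (f (t + X i) x - f t x) / X i) = ((LINT x|M. f (t + X i) x) - (LINT x|M. f t x)) / X i" for i
    proof -
      have "integrable M (f (t + X i))" "integrable M (f t)" using integ tX(1)[of i] t by auto
      then show ?thesis by simp
    qed
    show "(\<lambda>i. ((LINT x|M. f (t + X i) x) - (LINT x|M. f t x)) / X i) \<longlonglongrightarrow> (LINT x|M. f' t x)"
      using lim unfolding eq .
  qed
  moreover have "at 0 within {-\<delta><..<\<delta>} = at (0::real)"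
    using \<delta> by (intro at_within_open) auto
  ultimately show "((\<lambda>s. LINT x|M. f s x) has_real_derivative (LINT x|M. f' t x)) (at t)"
    by (simp add: DERIV_def)
qed

section \<open>Monotonicity in time and the waiting time\<close>

text \<open>
  The evolution with unit rate, abstracted to what the argument uses: \<open>S\<close> is the closure of the initial
  domain and \<open>M0\<close> a bound of the initial datum there. The bound of \<open>\<gamma> t\<close> in space is allowed to depend on \<open>t\<close>
  in an arbitrary way.
\<close>

locale stefan_flow = dispersal_kernel k K for k :: "'a::euclidean_space \<Rightarrow> real" and K +
  fixes S :: "'a set" and l0 M0 :: real and \<gamma> :: "real \<Rightarrow> 'a \<Rightarrow> real"
  assumes S: "compact S"
    and l0: "0 < l0"
    and outside: "x \<notin> S \<Longrightarrow> \<gamma> 0 x = - l0"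
    and inside: "x \<in> S \<Longrightarrow> 0 \<le> \<gamma> 0 x" "x \<in> S \<Longrightarrow> \<gamma> 0 x \<le> M0"
    and M0: "0 \<le> M0"
    and meas_space: "0 \<le> t \<Longrightarrow> \<gamma> t \<in> borel_measurable lebesgue"
    and ess_bounded: "0 < t \<Longrightarrow> \<exists>C. AE x in lebesgue. \<bar>\<gamma> t x\<bar> \<le> C"
    and cont_time: "continuous_on {0..} (\<lambda>t. \<gamma> t x)"
    and evolution: "0 < t \<Longrightarrow> ((\<lambda>s. \<gamma> s x) has_real_derivative
        convol k (\<lambda>y. max 0 (\<gamma> t y)) x - max 0 (\<gamma> t x)) (at t)"
begin

definition u :: "real \<Rightarrow> 'a \<Rightarrow> real" where "u t x = max 0 (\<gamma> t x)"

lemma u_nonneg: "0 \<le> u t x" by (simp add: u_def)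

lemma u_meas: "0 \<le> t \<Longrightarrow> u t \<in> borel_measurable lebesgue"
  unfolding u_def[abs_def] using meas_space by auto

lemma deriv: "0 < t \<Longrightarrow> ((\<lambda>s. \<gamma> s x) has_real_derivative convol k (u t) x - u t x) (at t)"
  using evolution[of t x] by (simp add: u_def[abs_def])

lemma gain_nonneg: "0 \<le> convol k (u t) x"
  by (rule convol_nonneg) (rule u_nonneg)

lemma cont_interval: "0 \<le> a \<Longrightarrow> continuous_on {a..b} (\<lambda>t. \<gamma> t x)"
  by (rule continuous_on_subset[OF cont_time]) auto

text \<open>
  The loss term \<open>u\<close> vanishes where \<open>\<gamma>\<close> is negative, so the square of the negative part has derivative
  \<open>- 2 * max 0 (- \<gamma>) * (k * u) \<le> 0\<close>.
\<close>

lemma neg_part_mono: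
  assumes "0 \<le> s" "s \<le> t"
  shows "min 0 (\<gamma> s x) \<le> min 0 (\<gamma> t x)"
proof -
  have "(max 0 (- \<gamma> t x))\<^sup>2 \<le> (max 0 (- \<gamma> s x))\<^sup>2"
  proof (rule deriv_comparison[of s t _ "\<lambda>_. (max 0 (- \<gamma> s x))\<^sup>2" _ "\<lambda>_. 0"])
    show "continuous_on {s..t} (\<lambda>r. (max 0 (- \<gamma> r x))\<^sup>2)"
      using assms by (intro continuous_intros cont_interval)
    fix r assume r: "s < r" "r < t"
    show "((\<lambda>r. (max 0 (- \<gamma> r x))\<^sup>2) has_real_derivative
        2 * max 0 (- \<gamma> r x) * - (convol k (u r) x - u r x)) (at r)"
      using r assms by (intro DERIV_chain2[OF deriv_square_pos_part] DERIV_minus deriv) auto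
    have zero: "max 0 (- \<gamma> r x) * u r x = 0"
      by (auto simp: u_def max_def)
    have gain: "0 \<le> max 0 (- \<gamma> r x) * convol k (u r) x"
      by (intro mult_nonneg_nonneg gain_nonneg) simp
    have expand: "2 * m * - (c - w) = 2 * (m * w) - 2 * (m * c)" for m c w :: real
      by algebra
    show "2 * max 0 (- \<gamma> r x) * - (convol k (u r) x - u r x) \<le> 0"
      unfolding expand zero using gain by linarith
  qed (use assms in auto)
  then have "max 0 (- \<gamma> t x) \<le> max 0 (- \<gamma> s x)"
    by (rule power2_le_imp_le) simp
  then show ?thesis by linarith
qed

lemma stays_nonneg: "0 \<le> s \<Longrightarrow> s \<le> t \<Longrightarrow> 0 \<le> \<gamma> s x \<Longrightarrow> 0 \<le> \<gamma> t x"
  using neg_part_mono[of s t x] by linarith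

lemma lower_bound: "0 \<le> t \<Longrightarrow> - l0 \<le> \<gamma> t x"
  using neg_part_mono[of 0 t x] outside[of x] inside(1)[of x] l0 by (cases "x \<in> S") auto

text \<open>
  Once \<open>\<gamma>\<close> is nonnegative it stays so, and then \<open>\<gamma>' \<ge> - \<gamma>\<close>.
\<close>

lemma exp_pos_part_mono:
  assumes "0 \<le> s" "s \<le> t"
  shows "exp s * u s x \<le> exp t * u t x"
proof (cases "0 \<le> \<gamma> s x")
  case True
  have "exp s * \<gamma> s x \<le> exp t * \<gamma> t x"
  proof (rule deriv_comparison[of s t "\<lambda>_. exp s * \<gamma> s x" _ "\<lambda>_. 0"])
    show "continuous_on {s..t} (\<lambda>r. exp r * \<gamma> r x)"
      using assms by (intro continuous_intros cont_interval)
    fix r assume r: "s < r" "r < t"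
    show "((\<lambda>r. exp r * \<gamma> r x) has_real_derivative
        exp r * \<gamma> r x + (convol k (u r) x - u r x) * exp r) (at r)"
      using r assms by (intro DERIV_mult DERIV_exp deriv) auto
    have "u r x = \<gamma> r x" using stays_nonneg[of s r x] True r assms by (simp add: u_def)
    then show "0 \<le> exp r * \<gamma> r x + (convol k (u r) x - u r x) * exp r"
      using gain_nonneg[of r x] by (simp add: algebra_simps)
  qed (use assms in auto)
  then show ?thesis
    using True stays_nonneg[OF assms True] by (simp add: u_def)
qed (simp add: u_def)

text \<open>
  Looking backwards from time \<open>T\<close>: by \<open>exp_pos_part_mono\<close> the values of \<open>u\<close> on \<open>[0, T]\<close> are at most
  \<open>exp T * u T\<close>. This turns boundedness in space at the single time \<open>T\<close> into a bound that is uniform in time.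
\<close>

lemma gain_bounded:
  assumes T: "0 < T"
  obtains C where "0 \<le> C" "\<And>t x. 0 \<le> t \<Longrightarrow> t \<le> T \<Longrightarrow> convol k (u t) x \<le> C"
proof -
  obtain C where C: "AE x in lebesgue. \<bar>\<gamma> T x\<bar> \<le> C" using ess_bounded[OF T] by blast
  show ?thesis
  proof (rule that[of "exp T * \<bar>C\<bar>"])
    fix t x assume t: "0 \<le> t" "t \<le> T"
    have "AE y in lebesgue. u t y \<le> exp T * \<bar>C\<bar>"
      using C
    proof eventually_elim
      case (elim y)
      have "u t y \<le> exp t * u t y" using t u_nonneg[of t y] by (simp add: mult_le_cancel_right1)
      also have "\<dots> \<le> exp T * u T y" using t by (rule exp_pos_part_mono)
      also have "\<dots> \<le> exp T * \<bar>C\<bar>" using elim abs_ge_self[of "\<gamma> T y"] abs_ge_self[of C] by (simp add: u_def del: abs_ge_self)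
      finally show ?case .
    qed
    then show "convol k (u t) x \<le> exp T * \<bar>C\<bar>"
      by (intro convol_le_const u_meas t u_nonneg)
  qed simp
qed

lemma linear_growth:
  assumes C: "\<And>t. a < t \<Longrightarrow> t < b \<Longrightarrow> convol k (u t) x \<le> C" and ab: "0 \<le> a" "a \<le> b"
  shows "\<gamma> b x \<le> \<gamma> a x + C * (b - a)"
proof (rule deriv_comparison[of a b _ _ "\<lambda>t. convol k (u t) x - u t x" "\<lambda>_. C"])
  show "convol k (u t) x - u t x \<le> C" if "a < t" "t < b" for t
    using C[OF that] u_nonneg[of t x] by linarith
qed (use ab in \<open>auto intro!: deriv cont_interval continuous_intros derivative_eq_intros\<close>)

lemma Omega_0: "Omega \<gamma> 0 = S"
  using outside inside l0 by (force simp: Omega_def)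

lemma Omega_mono: "0 \<le> s \<Longrightarrow> s \<le> t \<Longrightarrow> Omega \<gamma> s \<subseteq> Omega \<gamma> t"
  using stays_nonneg by (auto simp: Omega_def)

lemma waiting_time: "\<exists>t0>0. \<forall>t. 0 \<le> t \<and> t \<le> t0 \<longrightarrow> Omega \<gamma> t = Omega \<gamma> 0"
proof -
  obtain C where C: "0 \<le> C" "\<And>t x. 0 \<le> t \<Longrightarrow> t \<le> 1 \<Longrightarrow> convol k (u t) x \<le> C"
    using gain_bounded[of 1] by auto
  define t0 where "t0 = min 1 (l0 / (2 * (C + 1)))"
  have t0: "0 < t0" "t0 \<le> 1" "C * t0 < l0"
  proof -
    have "C * t0 \<le> C * (l0 / (2 * (C + 1)))" using C by (intro mult_left_mono) (auto simp: t0_def)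
    also have "\<dots> < l0" using C(1) l0 by (simp add: field_simps add_nonneg_pos)
    finally show "C * t0 < l0" .
  qed (use C l0 in \<open>auto simp: t0_def\<close>)
  have "\<gamma> t x < 0" if "0 \<le> t" "t \<le> t0" "x \<notin> S" for t x
  proof -
    have "\<gamma> t x \<le> \<gamma> 0 x + C * (t - 0)"
      using that t0 by (intro linear_growth C) auto
    also have "C * (t - 0) \<le> C * t0" using that C by (simp add: mult_left_mono)
    finally show ?thesis using outside[OF \<open>x \<notin> S\<close>] t0 by linarith
  qed
  then have "Omega \<gamma> t = Omega \<gamma> 0" if "0 \<le> t" "t \<le> t0" for t
    using that Omega_mono[of 0 t] unfolding Omega_0 by (fastforce simp: Omega_def)
  then show ?thesis using t0(1) by blast
qed

end

section \<open>Heat balance, decay and confinement\<close>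

locale majorized_flow = stefan_flow k K S l0 M0 \<gamma>
  for k :: "'a::euclidean_space \<Rightarrow> real" and K S l0 M0 \<gamma> +
  fixes H :: "'a \<Rightarrow> real" and B :: real
  assumes H_meas: "H \<in> borel_measurable lebesgue"
    and H_int: "integrable lebesgue H"
    and H_nonneg: "0 \<le> H x"
    and H_bound: "H x \<le> B"
    and H_init: "x \<in> S \<Longrightarrow> M0 \<le> H x"
    and H_super: "convol k H x \<le> 2 * H x"
begin

text \<open>
  A comparison principle for bounded functions on an unbounded domain, proved by Picard iteration: any bound
  \<open>C\<close> of \<open>u\<close> can be fed into \<open>\<gamma>' \<le> k * u\<close>. The term \<open>exp (2 * s) * H\<close> reproduces itself because
  \<open>k * H \<le> 2 * H\<close>, and the error \<open>C * s ^ J / fact J\<close> is integrated to the next one because convolution with \<open>k\<close>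
  leaves constants unchanged. As \<open>J\<close> grows the error disappears.
\<close>

lemma u_le_series:
  assumes T: "0 < T" and C: "\<And>s y. 0 \<le> s \<Longrightarrow> s \<le> T \<Longrightarrow> u s y \<le> C" and s: "0 \<le> s" "s \<le> T"
  shows "u s y \<le> exp (2 * s) * H y + C * (s ^ J / fact J)"
  using s
proof (induction J arbitrary: s y)
  case 0
  then show ?case using C[of s y] H_nonneg[of y] by (simp add: add_increasing)
next
  case (Suc J)
  have C0: "0 \<le> C" using C[of 0 undefined] u_nonneg[of 0 undefined] T by linarith
  have "\<gamma> s y \<le> exp (2 * s) * H y + C * (s ^ Suc J / fact (Suc J))"
  proof (rule deriv_comparison[of 0 s _ _ "\<lambda>r. convol k (u r) y - u r y" "\<lambda>r. exp (2 * r) * (2 * H y) + C * (r ^ J / fact J)"])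
    show "continuous_on {0..s} (\<lambda>r. exp (2 * r) * H y + C * (r ^ Suc J / fact (Suc J)))"
      by (intro continuous_intros) auto
    show "\<gamma> 0 y \<le> exp (2 * 0) * H y + C * (0 ^ Suc J / fact (Suc J))"
      using inside(2)[of y] H_init[of y] outside[of y] l0 H_nonneg[of y] by (cases "y \<in> S") auto
    fix r assume r: "0 < r" "r < s"
    show "((\<lambda>r. \<gamma> r y) has_real_derivative convol k (u r) y - u r y) (at r)"
      using r by (intro deriv)
    have "((\<lambda>r. r ^ Suc J / fact (Suc J)) has_real_derivative r ^ J / fact J) (at r)"
      by (rule derivative_eq_intros refl | simp)+
    moreover have "((\<lambda>r. exp (2 * r) * H y) has_real_derivative exp (2 * r) * (2 * H y)) (at r)"
      by (auto intro!: derivative_eq_intros)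
    ultimately show "((\<lambda>r. exp (2 * r) * H y + C * (r ^ Suc J / fact (Suc J))) has_real_derivative
        exp (2 * r) * (2 * H y) + C * (r ^ J / fact J)) (at r)"
      by (intro DERIV_add DERIV_cmult)
    have B: "\<bar>H z\<bar> \<le> B" for z using H_nonneg[of z] H_bound[of z] by simp
    have "convol k (u r) y \<le> convol k (\<lambda>z. exp (2 * r) * H z + C * (r ^ J / fact J)) y"
    proof (rule convol_mono)
      show "AE z in lebesgue. \<bar>u r z\<bar> \<le> C"
        using C[of r] u_nonneg[of r] r Suc.prems by (intro AE_I2) simp
      show "(\<lambda>z. exp (2 * r) * H z + C * (r ^ J / fact J)) \<in> borel_measurable lebesgue"
        using H_meas by measurable
      show "AE z in lebesgue. \<bar>exp (2 * r) * H z + C * (r ^ J / fact J)\<bar> \<le> exp (2 * r) * B + C * (r ^ J / fact J)"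
        using r C0 H_nonneg H_bound by (intro AE_I2) simp
      show "AE z in lebesgue. u r z \<le> exp (2 * r) * H z + C * (r ^ J / fact J)"
        using Suc.IH[of r] r Suc.prems by (intro AE_I2) simp
    qed (use r in \<open>simp add: u_meas\<close>)
    also have "\<dots> = exp (2 * r) * convol k H y + C * (r ^ J / fact J)"
      by (rule convol_affine[OF H_meas, of B]) (use B in simp)
    also have "\<dots> \<le> exp (2 * r) * (2 * H y) + C * (r ^ J / fact J)"
      using H_super[of y] by simp
    finally show "convol k (u r) y - u r y \<le> exp (2 * r) * (2 * H y) + C * (r ^ J / fact J)"
      using u_nonneg[of r y] by linarith
  qed (use Suc.prems in \<open>auto intro: cont_interval\<close>)
  moreover have "0 \<le> exp (2 * s) * H y + C * (s ^ Suc J / fact (Suc J))"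
    using H_nonneg[of y] C0 Suc.prems by (intro add_nonneg_nonneg mult_nonneg_nonneg) auto
  ultimately show ?case by (simp add: u_def)
qed

lemma u_le_majorant:
  assumes "0 \<le> t"
  shows "u t x \<le> exp (2 * t) * H x"
proof -
  define T where "T = t + 1"
  have T: "0 < T" "t \<le> T" using assms by (auto simp: T_def)
  obtain C where C: "0 \<le> C" "\<And>t x. 0 \<le> t \<Longrightarrow> t \<le> T \<Longrightarrow> convol k (u t) x \<le> C"
    using gain_bounded[OF T(1)] by blast
  have bound: "u s y \<le> M0 + C * T" if s: "0 \<le> s" "s \<le> T" for s y
  proof -
    have "\<gamma> s y \<le> \<gamma> 0 y + C * (s - 0)" using s by (intro linear_growth C) auto
    also have "\<dots> \<le> M0 + C * T"
      using inside(2)[of y] outside[of y] l0 M0 s C(1) by (intro add_mono mult_left_mono) force+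
    finally show ?thesis using M0 C(1) T by (simp add: u_def)
  qed
  have "(\<lambda>J. exp (2 * t) * H x + (M0 + C * T) * (t ^ J / fact J)) \<longlonglongrightarrow> exp (2 * t) * H x + (M0 + C * T) * 0"
    by (intro tendsto_intros summable_LIMSEQ_zero) (use summable_exp[of t] in \<open>simp add: field_simps\<close>)
  \<comment> \<open>The right-hand side is the limit of the Picard bounds as J grows.\<close>
  then have "u t x \<le> exp (2 * t) * H x + (M0 + C * T) * 0"
    by (rule LIMSEQ_le_const) (use u_le_series[OF T(1) bound assms T(2)] in blast)
  then show ?thesis by simp
qed

lemma u_le_const: "0 \<le> t \<Longrightarrow> u t x \<le> exp (2 * t) * B"
  by (rule order_trans[OF u_le_majorant mult_left_mono[OF H_bound]]) auto

lemma u_integrable: assumes "0 \<le> t" shows "integrable lebesgue (u t)" "integrable lebesgue (\<lambda>x. (u t x)\<^sup>2)"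
proof -
  note [measurable] = u_meas[OF assms]
  show "integrable lebesgue (u t)"
    by (rule Bochner_Integration.integrable_bound[OF integrable_mult_right[OF H_int, of "exp (2 * t)"]])
      (use u_le_majorant[OF assms] u_nonneg H_nonneg in \<open>auto intro!: AE_I2 simp: abs_mult\<close>)
  then have "integrable lebesgue (\<lambda>x. exp (2 * t) * B * u t x)" by simp
  then show "integrable lebesgue (\<lambda>x. (u t x)\<^sup>2)"
  proof (rule Bochner_Integration.integrable_bound)
    show "AE x in lebesgue. norm ((u t x)\<^sup>2) \<le> norm (exp (2 * t) * B * u t x)"
    proof (rule AE_I2)
      fix x
      have "u t x * u t x \<le> exp (2 * t) * B * u t x"
        by (intro mult_right_mono u_nonneg u_le_const assms)
      then show "norm ((u t x)\<^sup>2) \<le> norm (exp (2 * t) * B * u t x)"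
        by (simp add: power2_eq_square)
    qed
  qed measurable
qed

lemma gain_le_majorant:
  assumes t: "0 \<le> t"
  shows "convol k (u t) x \<le> exp (2 * t) * convol k H x"
proof -
  have "convol k (u t) x \<le> convol k (\<lambda>y. exp (2 * t) * H y + 0) x"
  proof (rule convol_mono)
    show "AE y in lebesgue. \<bar>exp (2 * t) * H y + 0\<bar> \<le> exp (2 * t) * B"
      using H_nonneg H_bound by (intro AE_I2) (simp add: abs_mult)
    show "AE y in lebesgue. \<bar>u t y\<bar> \<le> exp (2 * t) * B"
      using u_nonneg u_le_const[OF t] by (intro AE_I2) simp
  qed (use t u_meas u_le_majorant H_meas in auto)
  also have "\<dots> = exp (2 * t) * convol k H x + 0"
    by (rule convol_affine[OF H_meas, of B]) (use H_nonneg H_bound in \<open>auto intro!: AE_I2\<close>)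
  finally show ?thesis by simp
qed

lemma rate_bound:
  assumes "0 \<le> t" "t \<le> T"
  shows "\<bar>convol k (u t) x - u t x\<bar> \<le> 2 * exp (2 * T) * H x"
proof -
  have e: "exp (2 * t) * (2 * H x) \<le> exp (2 * T) * (2 * H x)"
    using assms H_nonneg by (intro mult_right_mono) auto
  have "convol k (u t) x \<le> exp (2 * t) * (2 * H x)"
    by (rule order_trans[OF gain_le_majorant[OF assms(1)] mult_left_mono[OF H_super]]) simp
  moreover have "u t x \<le> exp (2 * t) * (2 * H x)"
    by (rule order_trans[OF u_le_majorant[OF assms(1)]]) (use H_nonneg[of x] in \<open>intro mult_left_mono; simp\<close>)
  ultimately show ?thesis
    using gain_nonneg[of t x] u_nonneg[of t x] e by (simp add: abs_le_iff)
qed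

lemma gain_meas: "0 \<le> t \<Longrightarrow> convol k (u t) \<in> borel_measurable lebesgue"
  using convol_measurable[OF u_meas u_nonneg] by (auto intro: measurable_completion)

lemma S_finite_measure:
  "S \<in> sets lebesgue" "emeasure lebesgue S < \<infinity>" "integrable lebesgue (indicator S :: 'a \<Rightarrow> real)"
proof -
  show *: "S \<in> sets lebesgue" "emeasure lebesgue S < \<infinity>"
    using lmeasurable_compact[OF S] unfolding fmeasurable_def by blast+
  show "integrable lebesgue (indicator S :: 'a \<Rightarrow> real)"
    using * by (rule integrable_real_indicator)
qed

text \<open>
  The derivative of the integral is that of \<open>k * u - u\<close>, which is zero because convolution preserves mass. The
  initial datum is subtracted because it equals \<open>- l0\<close> off a compact set and is not integrable itself.
\<close>

lemma heat_balance:
  assumes t: "0 < t"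
  shows "integrable lebesgue (\<lambda>x. \<gamma> t x - \<gamma> 0 x)" "(LINT x|lebesgue. \<gamma> t x - \<gamma> 0 x) \<le> 0"
proof -
  define f where "f s x = \<gamma> s x - \<gamma> 0 x" for s x
  define f' where "f' s x = convol k (u s) x - u s x" for s x
  have meas: "f s \<in> borel_measurable lebesgue" if "0 \<le> s" "s \<le> t" for s
    unfolding f_def using meas_space[of s] meas_space[of 0] that by measurable
  have meas': "f' s \<in> borel_measurable lebesgue" if "0 < s" "s < t" for s
  proof -
    have "0 \<le> s" using that by simp
    note [measurable] = gain_meas[OF this] u_meas[OF this]
    show ?thesis unfolding f'_def by measurable
  qed
  have init: "integrable lebesgue (f 0)" by (simp add: f_def[abs_def])
  have cont: "continuous_on {0..t} (\<lambda>s. f s x)" for x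
    unfolding f_def by (intro continuous_intros cont_interval) simp
  have der: "((\<lambda>s. f s x) has_real_derivative f' s x) (at s)" if "0 < s" "s < t" for s x
    unfolding f_def f'_def using deriv[OF that(1), of x] by (auto intro!: derivative_eq_intros)
  have dom: "\<bar>f' s x\<bar> \<le> 2 * exp (2 * t) * H x" if "0 < s" "s < t" for s x
    unfolding f'_def using that by (intro rate_bound) auto
  have hi: "integrable lebesgue (\<lambda>x. 2 * exp (2 * t) * H x)" using H_int by simp
  note D = differentiate_under_integral[OF meas meas' init cont der dom hi t]
  show "integrable lebesgue (\<lambda>x. \<gamma> t x - \<gamma> 0 x)"
    using D(1)[of t] t by (simp add: f_def[abs_def])
  have "(LINT x|lebesgue. f t x) \<le> 0"
  proof (rule deriv_comparison[of 0 t _ "\<lambda>_. 0" _ "\<lambda>_. 0"])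
    fix s assume s: "0 < s" "s < t"
    show "((\<lambda>s. LINT x|lebesgue. f s x) has_real_derivative (LINT x|lebesgue. f' s x)) (at s)"
      by (rule D(3)) (use s in auto)
    show "(LINT x|lebesgue. f' s x) \<le> 0"
      using convol_mass[OF u_integrable(1) u_nonneg, of s] u_integrable(1)[of s] s by (simp add: f'_def)
  qed (use t D(2) in \<open>auto simp: f_def\<close>)
  then show "(LINT x|lebesgue. \<gamma> t x - \<gamma> 0 x) \<le> 0" by (simp add: f_def)
qed

text \<open>
  Latent heat: a point outside \<open>S\<close> that has become positive has absorbed at least \<open>l0\<close>, other points outside \<open>S\<close> have
  not lost anything, and points of \<open>S\<close> can have given away at most \<open>M0\<close>. By \<open>heat_balance\<close> the heat
  absorbed outside is at most the heat given away inside.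
\<close>

lemma positivity_set_measure:
  assumes t: "0 < t"
  shows "emeasure lebesgue {x. 0 < u t x} \<le> ennreal (measure lebesgue S + M0 / l0 * measure lebesgue S)"
proof -
  define D where "D = {x. 0 < u t x}"
  have Dm[measurable]: "D \<in> sets lebesgue"
    using measurable_sets[OF u_meas[of t], of "{0<..}"] t by (simp add: D_def vimage_def)
  note Sm[measurable] = S_finite_measure(1) and Sf = S_finite_measure(2) and Si = S_finite_measure(3)
  note hb = heat_balance[OF t]
  have le: "l0 * indicator (D - S) x \<le> (\<gamma> t x - \<gamma> 0 x) + M0 * indicator S x" for x
  proof (cases "x \<in> S")
    case True
    have "0 \<le> \<gamma> t x" by (rule stays_nonneg[OF _ _ inside(1)[OF True]]) (use t in auto)
    then show ?thesis using True inside(2)[OF True] by simp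
  next
    case False
    note out = outside[OF False]
    show ?thesis
    proof (cases "x \<in> D")
      case True
      then have "0 < \<gamma> t x" by (simp add: D_def u_def less_max_iff_disj)
      then show ?thesis using True False out by simp
    next
      case not_D: False
      have "- l0 \<le> \<gamma> t x" using t by (intro lower_bound) simp
      then show ?thesis using not_D False out by simp
    qed
  qed
  have ri: "integrable lebesgue (\<lambda>x. (\<gamma> t x - \<gamma> 0 x) + M0 * indicator S x)"
    using hb(1) Si by simp
  have Di: "integrable lebesgue (\<lambda>x. l0 * indicator (D - S) x)"
  proof (rule Bochner_Integration.integrable_bound[OF ri])
    show "AE x in lebesgue. norm (l0 * indicator (D - S) x) \<le> norm ((\<gamma> t x - \<gamma> 0 x) + M0 * indicator S x)"
    proof (rule AE_I2)
      fix x
      have "0 \<le> l0 * indicator (D - S) x" using l0 by simp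
      with le[of x] show "norm (l0 * indicator (D - S) x) \<le> norm ((\<gamma> t x - \<gamma> 0 x) + M0 * indicator S x)"
        by simp
    qed
  qed measurable
  then have Df: "emeasure lebesgue (D - S) < \<infinity>"
    using l0 by (simp add: integrable_indicator_iff)
  have "l0 * measure lebesgue (D - S) = (LINT x|lebesgue. l0 * indicator (D - S) x)"
    by simp
  also have "\<dots> \<le> (LINT x|lebesgue. (\<gamma> t x - \<gamma> 0 x) + M0 * indicator S x)"
    by (rule integral_mono[OF Di ri le])
  also have "\<dots> = (LINT x|lebesgue. \<gamma> t x - \<gamma> 0 x) + M0 * measure lebesgue S"
    using hb(1) Si by (subst Bochner_Integration.integral_add) auto
  also have "\<dots> \<le> M0 * measure lebesgue S"
    using hb(2) by simp
  finally have m: "measure lebesgue (D - S) \<le> M0 / l0 * measure lebesgue S"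
    using l0 by (simp add: field_simps)
  have "emeasure lebesgue D \<le> emeasure lebesgue (S \<union> (D - S))"
    by (rule emeasure_mono) auto
  also have "\<dots> \<le> emeasure lebesgue S + emeasure lebesgue (D - S)"
    by (rule emeasure_subadditive) auto
  also have "\<dots> = ennreal (measure lebesgue S + measure lebesgue (D - S))"
    using Sf Df by (simp add: emeasure_eq_ennreal_measure ennreal_plus)
  also have "\<dots> \<le> ennreal (measure lebesgue S + M0 / l0 * measure lebesgue S)"
    using m by (intro ennreal_leI) simp
  finally show ?thesis by (simp add: D_def)
qed

text \<open>
  Gronwall for the square integral \<open>y\<close> of \<open>u t\<close>: its derivative is twice the integral of
  \<open>u * (k * u - u)\<close>, hence at most \<open>- 2 * \<mu> * y\<close> by the spectral gap.
\<close>

lemma energy_decay: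
  assumes gap: "\<And>s. 0 < s \<Longrightarrow> (LINT x|lebesgue. u s x * convol k (u s) x) \<le> (1 - \<mu>) * (LINT x|lebesgue. (u s x)\<^sup>2)"
    and t: "0 < t"
  shows "(LINT x|lebesgue. (u t x)\<^sup>2) \<le> exp (- 2 * \<mu> * t) * (M0\<^sup>2 * measure lebesgue S)"
proof -
  define f where "f s x = (u s x)\<^sup>2" for s x
  define f' where "f' s x = 2 * u s x * (convol k (u s) x - u s x)" for s x
  have meas: "f s \<in> borel_measurable lebesgue" if "0 \<le> s" "s \<le> t" for s
    unfolding f_def using u_meas[of s] that by measurable
  have meas': "f' s \<in> borel_measurable lebesgue" if "0 < s" "s < t" for s
  proof -
    have "0 \<le> s" using that by simp
    note [measurable] = gain_meas[OF this] u_meas[OF this]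
    show ?thesis unfolding f'_def by measurable
  qed
  have init: "integrable lebesgue (f 0)" using u_integrable(2)[of 0] by (simp add: f_def[abs_def])
  have cont: "continuous_on {0..t} (\<lambda>s. f s x)" for x
    unfolding f_def u_def by (intro continuous_intros cont_interval) simp
  have der: "((\<lambda>s. f s x) has_real_derivative f' s x) (at s)" if "0 < s" "s < t" for s x
    unfolding f_def f'_def
    using DERIV_chain2[OF deriv_square_pos_part deriv[OF that(1), of x]] by (simp add: u_def)
  have dom: "\<bar>f' s x\<bar> \<le> 2 * (exp (2 * t) * B) * (2 * exp (2 * t) * H x)" if s: "0 < s" "s < t" for s x
  proof -
    have "exp (2 * s) * H x \<le> exp (2 * t) * B"
      using s H_nonneg[of x] H_bound[of x] by (intro mult_mono) auto
    then have "u s x \<le> exp (2 * t) * B" using u_le_majorant[of s x] s by simp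
    moreover have "\<bar>convol k (u s) x - u s x\<bar> \<le> 2 * exp (2 * t) * H x"
      using s by (intro rate_bound) auto
    ultimately show ?thesis
      unfolding f'_def abs_mult using u_nonneg[of s x] by (intro mult_mono) auto
  qed
  have hi: "integrable lebesgue (\<lambda>x. 2 * (exp (2 * t) * B) * (2 * exp (2 * t) * H x))" using H_int by simp
  note D = differentiate_under_integral[OF meas meas' init cont der dom hi t]
  define y where "y s = (LINT x|lebesgue. f s x)" for s
  have "exp (2 * \<mu> * t) * y t \<le> y 0"
  proof (rule deriv_comparison[of 0 t _ "\<lambda>_. y 0" _ "\<lambda>_. 0"])
    show "continuous_on {0..t} (\<lambda>s. exp (2 * \<mu> * s) * y s)"
      unfolding y_def by (intro continuous_intros D(2)) auto
    fix s assume s: "0 < s" "s < t"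
    show "((\<lambda>s. exp (2 * \<mu> * s) * y s) has_real_derivative
       exp (2 * \<mu> * s) * (2 * \<mu> * y s + (LINT x|lebesgue. f' s x))) (at s)"
    proof -
      have "(y has_real_derivative (LINT x|lebesgue. f' s x)) (at s)"
        unfolding y_def[abs_def] by (rule D(3)) (use s in auto)
      moreover have "((\<lambda>s. exp (2 * \<mu> * s)) has_real_derivative exp (2 * \<mu> * s) * (2 * \<mu>)) (at s)"
        by (auto intro!: derivative_eq_intros)
      ultimately have "((\<lambda>s. exp (2 * \<mu> * s) * y s) has_real_derivative
          exp (2 * \<mu> * s) * (2 * \<mu>) * y s + (LINT x|lebesgue. f' s x) * exp (2 * \<mu> * s)) (at s)"
        by (intro DERIV_mult)
      then show ?thesis by (simp add: algebra_simps)
    qed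
    have i1: "integrable lebesgue (f' s)"
    proof (rule Bochner_Integration.integrable_bound[OF hi meas'[OF s]], rule AE_I2)
      fix x
      show "norm (f' s x) \<le> norm (2 * (exp (2 * t) * B) * (2 * exp (2 * t) * H x))"
        unfolding real_norm_def by (rule order_trans[OF dom[OF s] abs_ge_self])
    qed
    have i2: "integrable lebesgue (\<lambda>x. u s x * convol k (u s) x)"
    proof -
      have "(\<lambda>x. u s x * convol k (u s) x) = (\<lambda>x. f' s x / 2 + (u s x)\<^sup>2)"
        by (auto simp: f'_def power2_eq_square field_simps)
      then show ?thesis using i1 u_integrable(2)[of s] s by simp
    qed
    have "(LINT x|lebesgue. f' s x) = (LINT x|lebesgue. 2 * (u s x * convol k (u s) x) - 2 * (u s x)\<^sup>2)"
      by (simp add: f'_def power2_eq_square algebra_simps)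
    also have "\<dots> = 2 * (LINT x|lebesgue. u s x * convol k (u s) x) - 2 * y s"
      using i2 u_integrable(2)[of s] s by (simp add: y_def f_def)
    also have "\<dots> \<le> 2 * ((1 - \<mu>) * y s) - 2 * y s"
      using gap[of s] s by (simp add: y_def f_def)
    finally have "2 * \<mu> * y s + (LINT x|lebesgue. f' s x) \<le> 0"
      by (simp add: algebra_simps)
    then show "exp (2 * \<mu> * s) * (2 * \<mu> * y s + (LINT x|lebesgue. f' s x)) \<le> 0"
      by (simp add: mult_le_0_iff)
  qed (use t in auto)
  also have "y 0 \<le> (LINT x|lebesgue. M0\<^sup>2 * indicator S x)"
    unfolding y_def
  proof (rule integral_mono)
    show "integrable lebesgue (\<lambda>x. M0\<^sup>2 * indicator S x)"
      using S_finite_measure(3) by simp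
    show "f 0 x \<le> M0\<^sup>2 * indicator S x" for x
      using inside[of x] outside[of x] l0 by (auto simp: f_def u_def indicator_def intro!: power_mono)
  qed (use init in simp)
  also have "\<dots> = M0\<^sup>2 * measure lebesgue S"
    by simp
  finally have "exp (2 * \<mu> * t) * y t \<le> M0\<^sup>2 * measure lebesgue S" .
  then have "exp (- 2 * \<mu> * t) * (exp (2 * \<mu> * t) * y t) \<le> exp (- 2 * \<mu> * t) * (M0\<^sup>2 * measure lebesgue S)"
    by (intro mult_left_mono) auto
  moreover have "exp (- 2 * \<mu> * t) * (exp (2 * \<mu> * t) * y t) = y t"
    by (simp add: exp_minus)
  ultimately show ?thesis
    by (simp only: y_def f_def)
qed

text \<open>
  Young's inequality with \<open>\<epsilon> = exp (- \<mu> * t)\<close>, which balances the two terms because the square integral of \<open>u t\<close> is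
  of order \<open>\<epsilon>\<^sup>2\<close>.
\<close>

lemma gain_decay:
  assumes gap: "\<And>s. 0 < s \<Longrightarrow> (LINT x|lebesgue. u s x * convol k (u s) x) \<le> (1 - \<mu>) * (LINT x|lebesgue. (u s x)\<^sup>2)"
    and t: "0 < t"
  shows "convol k (u t) x \<le> exp (- \<mu> * t) * ((K + M0\<^sup>2 * measure lebesgue S) / 2)"
proof -
  have "convol k (u t) x \<le> (exp (- \<mu> * t) * K + (LINT y|lebesgue. (u t y)\<^sup>2) / exp (- \<mu> * t)) / 2"
    using u_integrable(2)[of t] t by (intro convol_young u_nonneg) auto
  also have "(LINT y|lebesgue. (u t y)\<^sup>2) / exp (- \<mu> * t)
      \<le> exp (- 2 * \<mu> * t) * (M0\<^sup>2 * measure lebesgue S) / exp (- \<mu> * t)"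
    by (intro divide_right_mono energy_decay gap t) auto
  also have "\<dots> = exp (- \<mu> * t) * (M0\<^sup>2 * measure lebesgue S)"
  proof -
    have "exp (- 2 * \<mu> * t) = exp (- \<mu> * t) * exp (- \<mu> * t)" by (simp add: exp_add[symmetric])
    then show ?thesis by simp
  qed
  finally show ?thesis by (simp add: algebra_simps)
qed

text \<open>
  Up to time \<open>T\<close> the gain is controlled by the majorant, afterwards by its exponential decay; each part may raise
  \<open>\<gamma>\<close> from \<open>- l0\<close> by at most \<open>l0 / 4\<close>.
\<close>

lemma stays_negative:
  assumes gap: "\<And>s. 0 < s \<Longrightarrow> (LINT x|lebesgue. u s x * convol k (u s) x) \<le> (1 - \<mu>) * (LINT x|lebesgue. (u s x)\<^sup>2)"
    and \<mu>: "0 < \<mu>" and x: "x \<notin> S" and T: "0 < T" and \<delta>: "convol k H x \<le> \<delta>"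
    and small: "T * exp (2 * T) * \<delta> \<le> l0 / 4" "exp (- \<mu> * T) * ((K + M0\<^sup>2 * measure lebesgue S) / (2 * \<mu>)) \<le> l0 / 4"
    and t: "0 \<le> t"
  shows "\<gamma> t x < 0"
proof -
  have \<delta>0: "0 \<le> \<delta>" using convol_nonneg[of H x] H_nonneg \<delta> by simp
  have early: "\<gamma> s x \<le> - l0 + l0 / 4" if s: "0 \<le> s" "s \<le> T" for s
  proof -
    have "\<gamma> s x \<le> \<gamma> 0 x + exp (2 * T) * \<delta> * (s - 0)"
    proof (rule linear_growth)
      fix r assume r: "0 < r" "r < s"
      have "convol k (u r) x \<le> exp (2 * r) * convol k H x" using r by (intro gain_le_majorant) simp
      also have "\<dots> \<le> exp (2 * T) * \<delta>"
        using r s \<delta> convol_nonneg[of H x] H_nonneg by (intro mult_mono) auto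
      finally show "convol k (u r) x \<le> exp (2 * T) * \<delta>" .
    qed (use s in auto)
    also have "exp (2 * T) * \<delta> * (s - 0) \<le> exp (2 * T) * \<delta> * T"
      using s \<delta>0 by (intro mult_left_mono) auto
    also have "\<dots> \<le> l0 / 4" using small(1) by (simp add: ac_simps)
    finally show ?thesis using outside[OF x] by simp
  qed
  show ?thesis
  proof (cases "t \<le> T")
    case True
    then show ?thesis using early[OF t True] l0 by linarith
  next
    case False
    define c where "c = (K + M0\<^sup>2 * measure lebesgue S) / (2 * \<mu>)"
    have c0: "0 \<le> c" using K_nonneg \<mu> by (simp add: c_def)
    have "\<gamma> t x \<le> \<gamma> T x + c * (exp (- \<mu> * T) - exp (- \<mu> * t))"
    proof (rule deriv_comparison[of T t _ _ "\<lambda>r. convol k (u r) x - u r x" "\<lambda>r. exp (- \<mu> * r) * (c * \<mu>)"])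
      fix r assume r: "T < r" "r < t"
      show "((\<lambda>r. \<gamma> T x + c * (exp (- \<mu> * T) - exp (- \<mu> * r))) has_real_derivative exp (- \<mu> * r) * (c * \<mu>)) (at r)"
        by (auto intro!: derivative_eq_intros)
      have c: "c * \<mu> = (K + M0\<^sup>2 * measure lebesgue S) / 2" using \<mu> by (simp add: c_def)
      have "convol k (u r) x \<le> exp (- \<mu> * r) * (c * \<mu>)"
        unfolding c using r T by (intro gain_decay gap) auto
      then show "convol k (u r) x - u r x \<le> exp (- \<mu> * r) * (c * \<mu>)"
        using u_nonneg[of r x] by linarith
    qed (use T False in \<open>auto intro!: deriv cont_interval continuous_intros\<close>)
    also have "\<dots> \<le> \<gamma> T x + exp (- \<mu> * T) * c"
      using c0 by (simp add: algebra_simps)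
    also have "\<dots> \<le> - l0 + l0 / 4 + l0 / 4"
      using early[of T] T small(2) unfolding c_def by (intro add_mono) auto
    finally show ?thesis using l0 by linarith
  qed
qed

end

section \<open>Uniform confinement and the change of clock\<close>

text \<open>
  A continuous function exceeds \<open>M\<close> on an open set, and nonempty open sets are not null sets.
\<close>

lemma bounded_continuous_pointwise:
  fixes k :: "'a::euclidean_space \<Rightarrow> real"
  assumes cont: "continuous_on UNIV k" and bd: "AE x in lebesgue. \<bar>k x\<bar> \<le> M"
  shows "\<bar>k x\<bar> \<le> M"
proof (rule ccontr)
  assume x: "\<not> \<bar>k x\<bar> \<le> M"
  have op: "open {x. M < \<bar>k x\<bar>}"
    by (intro open_Collect_less continuous_intros cont)
  then have "{x. M < \<bar>k x\<bar>} \<in> sets lebesgue"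
    by (simp add: borel_open sets_completionI_sets)
  then have "emeasure lebesgue {x. M < \<bar>k x\<bar>} = 0"
    using AE_iff_measurable[of "{x. M < \<bar>k x\<bar>}" lebesgue "\<lambda>x. \<bar>k x\<bar> \<le> M"] bd by (auto simp: not_le)
  then have negl: "negligible {x. M < \<bar>k x\<bar>}"
    using \<open>{x. M < \<bar>k x\<bar>} \<in> sets lebesgue\<close> unfolding negligible_iff_null_sets by (rule null_setsI)
  have "x \<in> {x. M < \<bar>k x\<bar>}" using x by simp
  then have "{x. M < \<bar>k x\<bar>} \<noteq> {}" by blast
  from open_not_negligible[OF op this] negl show False by contradiction
qed

text \<open>
  In the clock \<open>t / d\<close> the chain rule cancels the factor \<open>d\<close>.
\<close>

lemma rescaled_solution_is_flow:
  assumes k: "dispersal_kernel k K"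
    and sol: "is_solution d k \<gamma>0 \<gamma>" and d: "0 < d"
    and g0: "\<gamma>0 \<in> borel_measurable lebesgue"
    and S: "compact S" and l0: "0 < l0" and M0: "0 \<le> M0"
    and out: "\<And>x. x \<notin> S \<Longrightarrow> \<gamma>0 x = - l0"
    and ins: "\<And>x. x \<in> S \<Longrightarrow> 0 \<le> \<gamma>0 x" "\<And>x. x \<in> S \<Longrightarrow> \<gamma>0 x \<le> M0"
  shows "stefan_flow k K S l0 M0 (\<lambda>t. \<gamma> (t / d))"
proof -
  interpret dispersal_kernel k K by fact
  have LI: "\<And>t. 0 < t \<Longrightarrow> L_infty (\<gamma> t)"
    and ct: "\<And>x. continuous_on {0..} (\<lambda>t. \<gamma> t x)"
    and de: "\<And>t x. 0 < t \<Longrightarrow> ((\<lambda>s. \<gamma> s x) has_real_derivative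
         (d * (LINT y:{y. \<gamma> t y > 0}|lebesgue. k (x - y) * \<gamma> t y)
          - d * \<gamma> t x * indicator {y. \<gamma> t y > 0} x)) (at t)"
    and init: "\<gamma> 0 = \<gamma>0"
    using sol by (auto simp: is_solution_def)
  show ?thesis
  proof
    show "\<gamma> (t / d) \<in> borel_measurable lebesgue" if "0 \<le> t" for t
      using that LI[of "t / d"] d g0 init by (cases "t = 0") (auto simp: L_infty_def)
    show "\<exists>C. AE x in lebesgue. \<bar>\<gamma> (t / d) x\<bar> \<le> C" if "0 < t" for t
      using that LI[of "t / d"] d by (auto simp: L_infty_def)
    show "continuous_on {0..} (\<lambda>t. \<gamma> (t / d) x)" for x
      using d by (intro continuous_on_compose2[OF ct]) (auto intro!: continuous_intros)
    show "((\<lambda>s. \<gamma> (s / d) x) has_real_derivative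
        convol k (\<lambda>y. max 0 (\<gamma> (t / d) y)) x - max 0 (\<gamma> (t / d) x)) (at t)" if t: "0 < t" for t x
    proof -
      have 1: "convol k (\<lambda>y. max 0 (\<gamma> (t / d) y)) x = (LINT y:{y. \<gamma> (t / d) y > 0}|lebesgue. k (x - y) * \<gamma> (t / d) y)"
        unfolding convol_def set_lebesgue_integral_def
        by (intro Bochner_Integration.integral_cong) (auto simp: indicator_def)
      have 2: "max 0 (\<gamma> (t / d) x) = \<gamma> (t / d) x * indicator {y. \<gamma> (t / d) y > 0} x"
        by (auto simp: indicator_def)
      have "((\<lambda>s. s / d) has_real_derivative 1 / d) (at t)"
        using d by (auto intro!: derivative_eq_intros)
      from DERIV_chain2[OF de this, of x] t d
      have "((\<lambda>s. \<gamma> (s / d) x) has_real_derivative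
         (d * convol k (\<lambda>y. max 0 (\<gamma> (t / d) y)) x - d * max 0 (\<gamma> (t / d) x)) * (1 / d)) (at t)"
        by (simp add: 1 2 mult.assoc)
      moreover have "(d * a - d * b) * (1 / d) = a - b" for a b
        using d by (simp add: right_diff_distrib[symmetric])
      ultimately show ?thesis by (simp only:)
    qed
  qed (use S l0 M0 out ins init in auto)
qed

text \<open>
  The order of the choices matters: the gap \<open>\<mu>\<close> is fixed by the support bound \<open>A\<close>, then \<open>T\<close> by the decay rate
  \<open>\<mu>\<close>, then the smallness \<open>\<delta>\<close> of \<open>k * H\<close> by \<open>T\<close>, and only then the radius. None of them refers to a particular flow.
\<close>

lemma (in dispersal_kernel) uniform_confinement:
  fixes S :: "'a set"
  assumes S: "compact S" and l0: "0 < l0" and M0: "0 \<le> M0"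
  obtains R where "0 < R"
    "\<And>\<gamma> t x. stefan_flow k K S l0 M0 \<gamma> \<Longrightarrow> 0 \<le> t \<Longrightarrow> 0 \<le> \<gamma> t x \<Longrightarrow> norm x < R"
proof -
  have Sb: "S \<in> sets borel" and Sf: "emeasure lborel S < \<infinity>"
    using S emeasure_bounded_finite[OF compact_imp_bounded[OF S]] by (auto simp: borel_compact)
  obtain H where H: "H \<in> borel_measurable lebesgue" "integrable lebesgue H"
    "\<And>y. M0 * indicator S y \<le> H y" "\<And>y. H y \<le> 2 * M0" "\<And>x. convol k H x \<le> 2 * H x"
    by (rule supersolution_exists[of "\<lambda>y. M0 * indicator S y" M0])
      (use Sb M0 integrable_real_indicator[of S lborel] Sf in \<open>simp_all add: mult_left_le\<close>)
  have H0: "0 \<le> H y" for y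
    by (rule order_trans[OF _ H(3)]) (simp add: M0)
  \<comment> \<open>The summand 1 keeps A positive when S is a null set.\<close>
  define A where "A = measure lebesgue S + M0 / l0 * measure lebesgue S + 1"
  have A: "0 < A" using l0 M0 by (simp add: A_def add_nonneg_pos)
  obtain \<mu> where \<mu>: "0 < \<mu>" and gap: "\<And>u. integrable lebesgue u \<Longrightarrow> integrable lebesgue (\<lambda>x. (u x)\<^sup>2) \<Longrightarrow>
      (\<And>x. 0 \<le> u x) \<Longrightarrow> emeasure lebesgue {x. u x > 0} \<le> ennreal A \<Longrightarrow>
      (LINT x|lebesgue. u x * convol k u x) \<le> (1 - \<mu>) * (LINT x|lebesgue. (u x)\<^sup>2)"
    using dissipation[OF A] by blast
  define c where "c = (K + M0\<^sup>2 * measure lebesgue S) / (2 * \<mu>)"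
  have "((\<lambda>T. exp (- \<mu> * T) * c) \<longlongrightarrow> 0 * c) at_top"
    using \<mu> by (intro tendsto_mult_right filterlim_compose[OF exp_at_bot]
        filterlim_tendsto_neg_mult_at_bot[OF tendsto_const _ filterlim_ident]) auto
  then have "\<forall>\<^sub>F T in at_top. exp (- \<mu> * T) * c < l0 / 4"
    using l0 by (intro order_tendstoD(2)) auto
  then have "\<forall>\<^sub>F T in at_top. exp (- \<mu> * T) * c < l0 / 4 \<and> 0 < T"
    using eventually_gt_at_top[of "0::real"] by eventually_elim simp
  then obtain T where T: "exp (- \<mu> * T) * c < l0 / 4" "0 < T"
    unfolding eventually_at_top_linorder by blast
  define \<delta> where "\<delta> = l0 / 4 / (T * exp (2 * T))"
  have \<delta>: "0 < \<delta>" "T * exp (2 * T) * \<delta> \<le> l0 / 4"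
    using T l0 by (auto simp: \<delta>_def)
  obtain R1 where R1: "0 < R1" "\<And>x. R1 \<le> norm x \<Longrightarrow> convol k H x \<le> \<delta>"
    using convol_vanishes_at_infinity[OF H(2) H0 H(4) \<delta>(1)] by blast
  obtain R2 where R2: "\<And>x. x \<in> S \<Longrightarrow> norm x \<le> R2"
    using compact_imp_bounded[OF S] by (auto simp: bounded_iff)
  show ?thesis
  proof (rule that[of "max R1 (R2 + 1)"])
    fix \<gamma> t x assume "stefan_flow k K S l0 M0 \<gamma>" and t: "0 \<le> (t::real)" and x: "0 \<le> \<gamma> t x"
    then interpret stefan_flow k K S l0 M0 \<gamma> by simp
    interpret majorized_flow k K S l0 M0 \<gamma> H "2 * M0"
    proof
      show "x \<in> S \<Longrightarrow> M0 \<le> H x" for x using H(3)[of x] by simp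
    qed (use H H0 in auto)
    show "norm x < max R1 (R2 + 1)"
    proof (rule ccontr)
      assume far: "\<not> norm x < max R1 (R2 + 1)"
      have "\<gamma> t x < 0"
      proof (rule stays_negative[OF _ \<mu>, of x T \<delta>])
        show "x \<notin> S" using far R2[of x] by auto
        show "convol k H x \<le> \<delta>" using far by (intro R1) auto
        show "exp (- \<mu> * T) * ((K + M0\<^sup>2 * measure lebesgue S) / (2 * \<mu>)) \<le> l0 / 4"
          using T(1) unfolding c_def by simp
        fix s :: real assume s: "0 < s"
        show "(LINT x|lebesgue. u s x * convol k (u s) x) \<le> (1 - \<mu>) * (LINT x|lebesgue. (u s x)\<^sup>2)"
        proof (rule gap)
          show "emeasure lebesgue {x. 0 < u s x} \<le> ennreal A"
            by (rule order_trans[OF positivity_set_measure[OF s]]) (auto simp: A_def intro: ennreal_leI)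
        qed (use s in \<open>auto simp: u_integrable u_nonneg\<close>)
      qed (use T \<delta> t in auto)
      with x show False by simp
    qed
  qed (use R1 in auto)
qed

theorem theorem3p1:
  fixes k :: "real ^ 'n \<Rightarrow> real"
    and \<Omega>0 :: "(real ^ 'n) set"
    and l0 :: real
    and \<gamma>0 :: "real ^ 'n \<Rightarrow> real"
  assumes "continuous_on UNIV k" and "L_infty k"
    and "\<And>x. k x \<ge> 0" and "k 0 > 0"
    and "integrable lebesgue k" and "(LINT x|lebesgue. k x) = 1"
    and "smooth_bounded_domain \<Omega>0"
    and "l0 > 0"
    and "L_infty \<gamma>0"
    and "\<And>x. x \<notin> closure \<Omega>0 \<Longrightarrow> \<gamma>0 x = - l0"
    and "\<And>x. x \<in> closure \<Omega>0 \<Longrightarrow> \<gamma>0 x \<ge> 0"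
    and "\<exists>x\<in>closure \<Omega>0. \<gamma>0 x \<noteq> 0"
    and "continuous_on (closure \<Omega>0) \<gamma>0"
  shows
    "(\<forall>d \<gamma>. d > 0 \<and> is_solution d k \<gamma>0 \<gamma> \<longrightarrow>
        (\<exists>t0>0. \<forall>t. 0 \<le> t \<and> t \<le> t0 \<longrightarrow> Omega \<gamma> t = Omega \<gamma> 0) \<and>
        (\<forall>t1 t2. 0 < t1 \<and> t1 < t2 \<longrightarrow> Omega \<gamma> t1 \<subseteq> Omega \<gamma> t2)) \<and>
     (\<exists>R>0. \<forall>d \<gamma>. d > 0 \<and> is_solution d k \<gamma>0 \<gamma> \<longrightarrow>
        (\<forall>t>0. Omega \<gamma> t \<subseteq> ball 0 R))"
proof -
  let ?S = "closure \<Omega>0"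
  have S: "compact ?S"
    using assms(7) by (simp add: smooth_bounded_domain_def)
  obtain K where K: "AE x in lebesgue. \<bar>k x\<bar> \<le> K"
    using assms(2) by (auto simp: L_infty_def)
  have kb: "k \<in> borel_measurable borel"
    using assms(1) by (rule borel_measurable_continuous_onI)
  have kernel: "dispersal_kernel k K"
  proof
    show "k x \<le> K" for x
      using bounded_continuous_pointwise[OF assms(1) K, of x] by simp
    show "integrable lborel k" "(LINT x|lborel. k x) = 1"
      using assms(5,6) kb by (simp_all add: integrable_completion integral_completion)
  qed (use assms in auto)
  obtain M0 where M0: "0 \<le> M0" "\<And>x. x \<in> ?S \<Longrightarrow> \<gamma>0 x \<le> M0"
  proof -
    have "bounded (\<gamma>0 ` ?S)"
      by (intro compact_imp_bounded compact_continuous_image assms(13) S)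
    then obtain M where M: "\<And>x. x \<in> ?S \<Longrightarrow> \<bar>\<gamma>0 x\<bar> \<le> M"
      by (auto simp: bounded_iff)
    show ?thesis
    proof (rule that[of "max 0 M"])
      show "x \<in> ?S \<Longrightarrow> \<gamma>0 x \<le> max 0 M" for x using M[of x] by simp
    qed simp
  qed
  have flow: "stefan_flow k K ?S l0 M0 (\<lambda>t. \<gamma> (t / d))" if "0 < d" "is_solution d k \<gamma>0 \<gamma>" for d \<gamma>
    using assms(9) by (intro rescaled_solution_is_flow[OF kernel that(2,1)] S assms M0) (auto simp: L_infty_def)
  have resc: "Omega (\<lambda>t. \<gamma> (t / d)) (d * t) = Omega \<gamma> t" if "0 < d" for d t :: real and \<gamma> :: "real \<Rightarrow> real ^ 'n \<Rightarrow> real"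
    using that by (simp add: Omega_def)
  have expansion: "(\<exists>t0>0. \<forall>t. 0 \<le> t \<and> t \<le> t0 \<longrightarrow> Omega \<gamma> t = Omega \<gamma> 0) \<and>
        (\<forall>t1 t2. 0 < t1 \<and> t1 < t2 \<longrightarrow> Omega \<gamma> t1 \<subseteq> Omega \<gamma> t2)"
    if d: "0 < d" and sol: "is_solution d k \<gamma>0 \<gamma>" for d \<gamma>
  proof -
    interpret stefan_flow k K ?S l0 M0 "\<lambda>t. \<gamma> (t / d)" using flow[OF d sol] .
    obtain \<tau> where \<tau>: "0 < \<tau>"
      and wait: "\<And>t. 0 \<le> t \<Longrightarrow> t \<le> \<tau> \<Longrightarrow> Omega (\<lambda>t. \<gamma> (t / d)) t = Omega (\<lambda>t. \<gamma> (t / d)) 0"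
      using waiting_time by blast
    have "Omega \<gamma> t = Omega \<gamma> 0" if t: "0 \<le> t" "t \<le> \<tau> / d" for t
    proof -
      have "0 \<le> d * t" "d * t \<le> \<tau>" using t d by (simp_all add: field_simps)
      from wait[OF this] show ?thesis
        using resc[OF d, of \<gamma> t] resc[OF d, of \<gamma> 0] by simp
    qed
    moreover have "0 < \<tau> / d" using \<tau> d by simp
    ultimately have 1: "\<exists>t0>0. \<forall>t. 0 \<le> t \<and> t \<le> t0 \<longrightarrow> Omega \<gamma> t = Omega \<gamma> 0"
      by blast
    have "Omega \<gamma> t1 \<subseteq> Omega \<gamma> t2" if "0 < t1" "t1 < t2" for t1 t2
      using Omega_mono[of "d * t1" "d * t2"] that d resc[OF d, of \<gamma>] by simp
    with 1 show ?thesis by blast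
  qed
  have "\<exists>R>0. \<forall>d \<gamma>. d > 0 \<and> is_solution d k \<gamma>0 \<gamma> \<longrightarrow> (\<forall>t>0. Omega \<gamma> t \<subseteq> ball 0 R)"
  proof -
    obtain R where R: "0 < R"
      and conf: "\<And>\<gamma> t x. stefan_flow k K ?S l0 M0 \<gamma> \<Longrightarrow> 0 \<le> t \<Longrightarrow> 0 \<le> \<gamma> t x \<Longrightarrow> norm x < R"
      using dispersal_kernel.uniform_confinement[OF kernel S assms(8) M0(1)] by blast
    have "Omega \<gamma> t \<subseteq> ball 0 R" if "0 < d" "is_solution d k \<gamma>0 \<gamma>" "0 < t" for d \<gamma> t
      using conf[OF flow[OF that(1,2)], of "d * t"] that by (auto simp: Omega_def)
    then show ?thesis using R by blast
  qed
  moreover have "\<forall>d \<gamma>. d > 0 \<and> is_solution d k \<gamma>0 \<gamma> \<longrightarrow>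
        (\<exists>t0>0. \<forall>t. 0 \<le> t \<and> t \<le> t0 \<longrightarrow> Omega \<gamma> t = Omega \<gamma> 0) \<and>
        (\<forall>t1 t2. 0 < t1 \<and> t1 < t2 \<longrightarrow> Omega \<gamma> t1 \<subseteq> Omega \<gamma> t2)"
    by (intro allI impI, elim conjE) (rule expansion)
  ultimately show ?thesis by (rule conjI[rotated])
qed

end
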